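(* Let $m\in\mathbb{R}$, $A\in\mathbb{C}^{2\times2}$, and let $z\in\mathbb{C}\setminus((-\infty,-|m|]\cup[|m|,+\infty))$ satisfy $\det\big(\sigma_0+\tfrac{i}{2}AZ(z)\big)\neq0$. Then $z$ lies in the resolvent set of $D_A$ and $(D_A-z)^{-1}$ is the integral operator on $L^2(\mathbb{R};\mathbb{C}^2)$ with kernel $$R^A_z(x,y)=R_z(x,y)-R_z(x,0)\Big(\sigma_0+\tfrac{i}{2}AZ(z)\Big)^{-1}AR_z(0,y).$$
   Context: Let $\sigma_0=I_2$, $\sigma_1=\begin{pmatrix}0&1\\1&0\end{pmatrix}$, $\sigma_3=\begin{pmatrix}1&0\\0&-1\end{pmatrix}$. Identify $L^2(\mathbb{R};\mathbb{C}^2)=L^2(\mathbb{R}_-;\mathbb{C}^2)\oplus L^2(\mathbb{R}_+;\mathbb{C}^2)$; for $\psi=\psi_-\oplus\psi_+\in H^1(\mathbb{R}_-;\mathbb{C}^2)\oplus H^1(\mathbb{R}_+;\mathbb{C}^2)$, $\psi(0_\pm)$ are the one-sided traces at $0$. Let $\mathscr{D}=-i\sigma_1\frac{d}{dx}+m\sigma_3$, and let $D_A$ be the operator with domain $\{\psi\in H^1(\mathbb{R}_-;\mathbb{C}^2)\oplus H^1(\mathbb{R}_+;\mathbb{C}^2) : (2i\sigma_1-A)\psi(0_+)=(2i\sigma_1+A)\psi(0_-)\}$ acting as $D_A\psi=\mathscr{D}\psi_-\oplus\mathscr{D}\psi_+$. Branch convention: $\mathrm{Im}\sqrt{w}>0$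 for $w\in\mathbb{C}\setminus[0,+\infty)$. For $z\in\mathbb{C}\setminus((-\infty,-|m|]\cup[|m|,+\infty))$ put $k(z)=\sqrt{z^2-m^2}$, $\zeta(z)=\frac{z+m}{k(z)}$, $Z(z)=\mathrm{diag}(\zeta(z),\zeta(z)^{-1})$, and $R_z(x,y)=\frac{i}{2}\big(Z(z)+\mathrm{sgn}(x-y)\sigma_1\big)e^{ik(z)|x-y|}$ (the integral kernel of $(D_0-z)^{-1}$, where $D_0$ is the free Dirac operator $\mathscr{D}$ on $H^1(\mathbb{R};\mathbb{C}^2)$); $R_z(x,0)$ and $R_z(0,y)$ are this formula with $\mathrm{sgn}(0)$ not needed for $x\neq0$, $y\neq 0$. *)

theory Defs
  imports "HOL-Analysis.Analysis"
begin

type_synonym cvec = "complex ^ 2"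
type_synonym cmat = "complex ^ 2 ^ 2"

definition sigma0 :: cmat where "sigma0 = mat 1"
definition sigma1 :: cmat where "sigma1 = vector [vector [0, 1], vector [1, 0]]"
definition sigma3 :: cmat where "sigma3 = vector [vector [1, 0], vector [0, -1]]"

definition cmat_scale :: "complex \<Rightarrow> cmat \<Rightarrow> cmat" where
  "cmat_scale c M = (\<chi> i j. c * M $ i $ j)"

text \<open>Branch of the square root with positive imaginary part (for w not in [0,+oo)).\<close>
definition sqrt_im_pos :: "complex \<Rightarrow> complex" where
  "sqrt_im_pos w = (THE s. s ^ 2 = w \<and> Im s > 0)"

definition kk :: "real \<Rightarrow> complex \<Rightarrow> complex" where
  "kk m z = sqrt_im_pos (z ^ 2 - (complex_of_real m) ^ 2)"

definition zeta :: "real \<Rightarrow> complex \<Rightarrow> complex" where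
  "zeta m z = (z + complex_of_real m) / kk m z"

definition ZZ :: "real \<Rightarrow> complex \<Rightarrow> cmat" where
  "ZZ m z = vector [vector [zeta m z, 0], vector [0, inverse (zeta m z)]]"

definition Rfree :: "real \<Rightarrow> complex \<Rightarrow> real \<Rightarrow> real \<Rightarrow> cmat" where
  "Rfree m z x y = cmat_scale ((\<i> / 2) * exp (\<i> * kk m z * complex_of_real \<bar>x - y\<bar>))
      (ZZ m z + cmat_scale (complex_of_real (sgn (x - y))) sigma1)"

definition RA :: "real \<Rightarrow> cmat \<Rightarrow> complex \<Rightarrow> real \<Rightarrow> real \<Rightarrow> cmat" where
  "RA m A z x y = Rfree m z x y -
     Rfree m z x 0 ** matrix_inv (sigma0 + cmat_scale (\<i> / 2) (A ** ZZ m z)) ** A ** Rfree m z 0 y"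

definition L2_on :: "real set \<Rightarrow> (real \<Rightarrow> cvec) \<Rightarrow> bool" where
  "L2_on S f \<longleftrightarrow> (\<lambda>x. indicator S x *\<^sub>R f x) \<in> borel_measurable lborel \<and>
      integrable lborel (\<lambda>x. indicator S x * (norm (f x))\<^sup>2)"

definition L2norm :: "(real \<Rightarrow> cvec) \<Rightarrow> real" where
  "L2norm f = sqrt (LINT x|lborel. (norm (f x))\<^sup>2)"

text \<open>H1R f c f': the restriction of f to R_+ lies in H^1(R_+), with weak derivative f'
  and one-sided trace f(0+) = c (f agrees a.e. on R_+ with c + integral_0^x f').\<close>
definition H1R :: "(real \<Rightarrow> cvec) \<Rightarrow> cvec \<Rightarrow> (real \<Rightarrow> cvec) \<Rightarrow> bool" where
  "H1R f c f' \<longleftrightarrow> L2_on {0<..} f \<and> L2_on {0<..} f' \<and>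
     (\<forall>x>0. set_integrable lborel {0..x} f') \<and>
     (AE x in lborel. x > 0 \<longrightarrow> f x = c + (LINT t:{0..x}|lborel. f' t))"

definition H1L :: "(real \<Rightarrow> cvec) \<Rightarrow> cvec \<Rightarrow> (real \<Rightarrow> cvec) \<Rightarrow> bool" where
  "H1L f c f' \<longleftrightarrow> L2_on {..<0} f \<and> L2_on {..<0} f' \<and>
     (\<forall>x<0. set_integrable lborel {x..0} f') \<and>
     (AE x in lborel. x < 0 \<longrightarrow> f x = c - (LINT t:{x..0}|lborel. f' t))"

definition DA_graph :: "real \<Rightarrow> cmat \<Rightarrow> (real \<Rightarrow> cvec) \<Rightarrow> (real \<Rightarrow> cvec) \<Rightarrow> bool" where
  "DA_graph m A psi chi \<longleftrightarrow> L2_on UNIV psi \<and> L2_on UNIV chi \<and>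
     (\<exists>cp cm psi'. H1R psi cp psi' \<and> H1L psi cm psi' \<and>
        (cmat_scale (2 * \<i>) sigma1 - A) *v cp = (cmat_scale (2 * \<i>) sigma1 + A) *v cm \<and>
        (AE x in lborel. chi x = cmat_scale (- \<i>) sigma1 *v psi' x
                               + cmat_scale (complex_of_real m) sigma3 *v psi x))"

text \<open>Resolvent set of an operator T on L^2(R;C^2) given by its graph (modulo a.e. equality):
  T - z is injective, onto L^2, and has a bounded inverse.\<close>
definition in_resolvent_set :: "((real \<Rightarrow> cvec) \<Rightarrow> (real \<Rightarrow> cvec) \<Rightarrow> bool) \<Rightarrow> complex \<Rightarrow> bool" where
  "in_resolvent_set T z \<longleftrightarrow>
     (\<forall>psi chi. T psi chi \<longrightarrow> (AE x in lborel. chi x = z *s psi x) \<longrightarrow> (AE x in lborel. psi x = 0)) \<and>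
     (\<forall>f. L2_on UNIV f \<longrightarrow> (\<exists>psi chi. T psi chi \<and> (AE x in lborel. chi x - z *s psi x = f x))) \<and>
     (\<exists>C. \<forall>psi chi. T psi chi \<longrightarrow> L2norm psi \<le> C * L2norm (\<lambda>x. chi x - z *s psi x))"

end

theory Submission
  imports Defs
begin

text \<open>
  Put \<open>M = i sigma1 (z - m sigma3)\<close>, so that the resolvent equation reads \<open>\<psi>' = M \<psi> + i sigma1 f\<close>
  on each half line. The kernel is dominated by a multiple of \<open>exp (- Im k |x - y|)\<close>, so Schur's test
  makes it a bounded operator on \<open>L\<^sup>2\<close>. Because \<open>M ZZ = i k sigma1\<close> and \<open>M sigma1 = i k ZZ\<close>,
  Fubini's theorem shows that \<open>\<psi>\<^sub>0 = \<integral> Rfree(\<cdot>, y) f(y) dy\<close> solves the equation on the whole line,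
  while \<open>Rfree(\<cdot>, 0) p\<close> solves the homogeneous one off the origin, with jump \<open>i sigma1 p\<close> and mean value
  \<open>(i/2) ZZ p\<close> there. The transmission condition for \<open>\<psi>\<^sub>0 - Rfree(\<cdot>, 0) p\<close> is then
  \<open>(sigma0 + (i/2) A ZZ) p = A \<psi>\<^sub>0(0)\<close>.

  For injectivity, \<open>\<psi>\<^sub>1 \<plusminus> zeta \<psi>\<^sub>2\<close> diagonalise the homogeneous equation; square integrability kills
  the growing mode on each side, and the transmission condition puts the remaining two amplitudes
  into the kernel of \<open>sigma0 + (i/2) A ZZ\<close>. Uniqueness carries the norm bound of the integral
  operator over to the inverse.
\<close>

subsection \<open>Schur's test for exponentially decaying kernels\<close>

lemma bounded_bilinear_matrix_vector_mult:
  "bounded_bilinear ((*v) :: complex^2^2 \<Rightarrow> complex^2 \<Rightarrow> complex^2)"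
  unfolding bilinear_conv_bounded_bilinear[symmetric] bilinear_def linear_iff
  by (auto simp: vec_eq_iff matrix_vector_mult_def sum.distrib algebra_simps scaleR_sum_right)

lemma bounded_bilinear_vector_scalar_mult:
  "bounded_bilinear ((*s) :: complex \<Rightarrow> complex^2 \<Rightarrow> complex^2)"
  unfolding bilinear_conv_bounded_bilinear[symmetric] bilinear_def linear_iff
  by (auto simp: vec_eq_iff algebra_simps)

text \<open>A bounded bilinear map is continuous on pairs. The instances for \<open>*v\<close> and
  \<open>*s\<close> registered below let \<open>measurable\<close> handle kernels built from
  matrices.\<close>

lemma borel_measurable_bounded_bilinear:
  fixes h :: "'b::{second_countable_topology, real_normed_vector} \<Rightarrow> 'c::{second_countable_topology, real_normed_vector} \<Rightarrow> 'd::real_normed_vector"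
  assumes h: "bounded_bilinear h" and f: "f \<in> borel_measurable M" and g: "g \<in> borel_measurable M"
  shows "(\<lambda>x. h (f x) (g x)) \<in> borel_measurable M"
  by (rule borel_measurable_continuous_Pair[OF f g])
    (intro bounded_bilinear.continuous_on[OF h] continuous_intros)

lemmas [measurable (raw)] =
  borel_measurable_bounded_bilinear[OF bounded_bilinear_matrix_vector_mult]
  borel_measurable_bounded_bilinear[OF bounded_bilinear_vector_scalar_mult]

lemma norm_vector_scalar_mult: "norm (c *s (v :: complex^2)) = norm c * norm v"
  by (simp add: norm_vec_def L2_set_def norm_mult power_mult_distrib sum_distrib_left[symmetric] real_sqrt_mult)

lemma integrable_exp_minus_abs:
  fixes \<kappa> :: real
  assumes "\<kappa> > 0"
  shows "integrable lborel (\<lambda>t. exp (- \<kappa> * \<bar>t\<bar>))"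
proof -
  have half: "integrable lborel (\<lambda>t. indicator {0..} t * exp (- \<kappa> * t))"
  proof (rule integrableI_nonneg)
    have "(\<integral>\<^sup>+t. ennreal (indicator {0..} t * exp (- \<kappa> * t)) \<partial>lborel)
        = (\<integral>\<^sup>+t\<in>{0..}. ennreal (exp (- \<kappa> * t)) \<partial>lborel)"
      by (intro nn_integral_cong) (auto simp: indicator_def)
    also have "\<dots> = ennreal (0 - (- exp (- \<kappa> * 0) / \<kappa>))"
    proof (rule nn_integral_FTC_atLeast)
      show "((\<lambda>t. - exp (- \<kappa> * t) / \<kappa>) has_real_derivative exp (- \<kappa> * t)) (at t)" for t
        using assms by (auto intro!: derivative_eq_intros simp: field_simps)
      have "((\<lambda>t. exp (- \<kappa> * t)) \<longlongrightarrow> 0) at_top"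
        using assms
        by (auto intro!: filterlim_compose[OF exp_at_bot] simp: filterlim_uminus_at_bot
            intro: filterlim_tendsto_pos_mult_at_top[OF tendsto_const _ filterlim_ident])
      then show "((\<lambda>t. - exp (- \<kappa> * t) / \<kappa>) \<longlongrightarrow> 0) at_top"
        using tendsto_divide[OF tendsto_minus tendsto_const[of \<kappa>]] assms by fastforce
    qed auto
    also have "\<dots> < \<infinity>" by simp
    finally show "(\<integral>\<^sup>+t. ennreal (indicator {0..} t * exp (- \<kappa> * t)) \<partial>lborel) < \<infinity>" .
  qed auto
  moreover have "integrable lborel (\<lambda>t. indicator {0..} (0 + -1 * t) * exp (- \<kappa> * (0 + -1 * t)))"
    by (rule lborel_integrable_real_affine[OF half]) simp
  ultimately have "integrable lborel (\<lambda>t. indicator {0..} t * exp (- \<kappa> * t)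
      + indicator {0..} (0 + -1 * t) * exp (- \<kappa> * (0 + -1 * t)))"
    by (rule Bochner_Integration.integrable_add)
  \<comment> \<open>The two halves overlap at t = 0, so their sum dominates the integrand rather
    than equals it.\<close>
  then show ?thesis
    by (rule Bochner_Integration.integrable_bound) (auto intro!: AE_I2 simp: indicator_def)
qed

lemma exp_minus_abs_translate:
  fixes \<kappa> :: real
  assumes "\<kappa> > 0"
  shows "integrable lborel (\<lambda>y. exp (- \<kappa> * \<bar>x - y\<bar>))"
    and "(LINT y|lborel. exp (- \<kappa> * \<bar>x - y\<bar>)) = (LINT t|lborel. exp (- \<kappa> * \<bar>t\<bar>))"
proof -
  show "integrable lborel (\<lambda>y. exp (- \<kappa> * \<bar>x - y\<bar>))"
    using lborel_integrable_real_affine[OF integrable_exp_minus_abs[OF assms], of "-1" x] by simp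
  show "(LINT y|lborel. exp (- \<kappa> * \<bar>x - y\<bar>)) = (LINT t|lborel. exp (- \<kappa> * \<bar>t\<bar>))"
    using lborel_integral_real_affine[of "-1" "\<lambda>t. exp (- \<kappa> * \<bar>t\<bar>)" x] by simp
qed

text \<open>Cauchy-Schwarz for the measure with density \<open>w\<close>: the integral of
  \<open>w y * (s - g y)\<^sup>2\<close> is a polynomial in s of degree at most two that is never
  negative.\<close>

lemma square_integral_le_weighted:
  fixes w g :: "real \<Rightarrow> real"
  assumes w: "integrable M w" and wg: "integrable M (\<lambda>y. w y * g y)"
    and wg2: "integrable M (\<lambda>y. w y * (g y)\<^sup>2)" and nonneg: "\<And>y. 0 \<le> w y"
  shows "(LINT y|M. w y * g y)\<^sup>2 \<le> (LINT y|M. w y) * (LINT y|M. w y * (g y)\<^sup>2)"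
proof -
  define a W G where "a = (LINT y|M. w y * g y)" and "W = (LINT y|M. w y)"
    and "G = (LINT y|M. w y * (g y)\<^sup>2)"
  have quad: "0 \<le> s\<^sup>2 * W - 2 * s * a + G" for s
  proof -
    have "0 \<le> (LINT y|M. w y * (s - g y)\<^sup>2)"
      by (intro integral_nonneg_AE AE_I2) (simp add: nonneg)
    also have "\<dots> = (LINT y|M. s\<^sup>2 * w y - 2 * s * (w y * g y) + w y * (g y)\<^sup>2)"
      by (intro Bochner_Integration.integral_cong) (auto simp: power2_diff algebra_simps power2_eq_square)
    also have "\<dots> = s\<^sup>2 * W - 2 * s * a + G"
      using w wg wg2 by (simp add: a_def W_def G_def)
    finally show ?thesis .
  qed
  have W0: "0 \<le> W" unfolding W_def by (intro integral_nonneg_AE AE_I2) (simp add: nonneg)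
  have "a\<^sup>2 \<le> W * G"
  proof (cases "W = 0")
    case True
    have "a = 0"
    proof (rule ccontr)
      assume "a \<noteq> 0"
      \<comment> \<open>For W = 0 the polynomial is affine in s, and this s gives it the value
        -1.\<close>
      then show False using quad[of "(G + 1) / (2 * a)"] True by (simp add: field_simps)
    qed
    then show ?thesis using True by simp
  next
    case False
    then have "W > 0" using W0 by simp
    \<comment> \<open>The polynomial attains its minimum at s = a / W.\<close>
    then show ?thesis using quad[of "a / W"] by (simp add: field_simps power2_eq_square)
  qed
  then show ?thesis by (simp add: a_def W_def G_def)
qed

text \<open>Schur's test: all row and column integrals of the exponential weight equal
  \<open>W\<close>. Weighted Cauchy-Schwarz on rows gives one factor \<open>W\<close>, exchanging
  the integrals gives the other. The second conclusion is uniform in x, which later justifies Fubini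
  over bounded intervals.\<close>

lemma exp_kernel:
  fixes h :: "real \<Rightarrow> real \<Rightarrow> 'a::{banach, second_countable_topology}" and G :: "real \<Rightarrow> real"
  assumes h: "case_prod h \<in> borel_measurable (lborel \<Otimes>\<^sub>M lborel)"
    and \<kappa>: "\<kappa> > 0"
    and bound: "\<And>x y. norm (h x y) \<le> exp (- \<kappa> * \<bar>x - y\<bar>) * G y"
    and Gm: "G \<in> borel_measurable lborel"
    and G2: "integrable lborel (\<lambda>y. (G y)\<^sup>2)"
  defines "W \<equiv> LINT t|lborel. exp (- \<kappa> * \<bar>t\<bar>)"
  shows "integrable lborel (h x)"
    and "(LINT y|lborel. norm (h x y)) \<le> W + (LINT y|lborel. (G y)\<^sup>2)"
    and "integrable lborel (\<lambda>x. (norm (LINT y|lborel. h x y))\<^sup>2)"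
    and "(LINT x|lborel. (norm (LINT y|lborel. h x y))\<^sup>2) \<le> W\<^sup>2 * (LINT y|lborel. (G y)\<^sup>2)"
proof -
  note [measurable] = h Gm
  define e where "e x y = exp (- \<kappa> * \<bar>x - y\<bar>)" for x y :: real
  have e_m [measurable]: "case_prod e \<in> borel_measurable (lborel \<Otimes>\<^sub>M lborel)"
    unfolding e_def by measurable
  have e0: "0 \<le> e x y" "e x y \<le> 1" for x y using \<kappa> by (auto simp: e_def)
  have e_int: "integrable lborel (e x)" "(LINT y|lborel. e x y) = W" for x
    unfolding e_def W_def using exp_minus_abs_translate[OF \<kappa>] by auto
  have e_sym: "e x y = e y x" for x y by (simp add: e_def abs_minus_commute)
  \<comment> \<open>On the diagonal the exponential is 1, so \<open>bound\<close> itself forces the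
    sign.\<close>
  have G0: "0 \<le> G y" for y using order_trans[OF norm_ge_zero bound[of y y]] by simp
  have eG2: "integrable lborel (\<lambda>y. e x y * (G y)\<^sup>2)" for x
    by (rule Bochner_Integration.integrable_bound[OF G2])
       (auto intro!: AE_I2 mult_left_le_one_le simp: e0 abs_mult)
  \<comment> \<open>\<open>G\<close> is only square integrable; \<open>e x y * G y\<close> is
    integrable because it lies below the sum of two integrable functions.\<close>
  have eG_le: "e x y * G y \<le> e x y + (G y)\<^sup>2" for x y
  proof -
    have "G y \<le> 1 + (G y)\<^sup>2" using zero_le_power2[of "G y - 1/2"] by (simp add: power2_diff field_simps)
    then have "e x y * G y \<le> e x y * (1 + (G y)\<^sup>2)" by (intro mult_left_mono e0)
    also have "\<dots> \<le> e x y + (G y)\<^sup>2" using mult_right_mono[OF e0(2)[of x y], of "(G y)\<^sup>2"] by (simp add: algebra_simps)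
    finally show ?thesis .
  qed
  have eG: "integrable lborel (\<lambda>y. e x y * G y)" for x
    by (rule Bochner_Integration.integrable_bound[OF Bochner_Integration.integrable_add[OF e_int(1)[of x] G2]])
       (auto intro!: AE_I2 simp: e0 abs_mult G0 eG_le add_nonneg_nonneg)
  have bnd: "norm (h x y) \<le> e x y * G y" for x y using bound by (simp add: e_def)
  show int_h: "integrable lborel (h x)" for x
    by (rule Bochner_Integration.integrable_bound[OF eG[of x]]) (use bnd in \<open>auto intro!: AE_I2 order_trans[OF bnd]\<close>)
  have norm_h_le: "(LINT y|lborel. norm (h x y)) \<le> (LINT y|lborel. e x y * G y)" for x
    using int_h eG bnd by (intro integral_mono) auto
  show "(LINT y|lborel. norm (h x y)) \<le> W + (LINT y|lborel. (G y)\<^sup>2)"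
  proof -
    have "(LINT y|lborel. e x y * G y) \<le> (LINT y|lborel. e x y + (G y)\<^sup>2)"
      using eG e_int(1) G2 eG_le by (intro integral_mono) auto
    then show ?thesis using norm_h_le[of x] e_int[of x] G2 by simp
  qed
  have sq: "(norm (LINT y|lborel. h x y))\<^sup>2 \<le> W * (LINT y|lborel. e x y * (G y)\<^sup>2)" for x
  proof -
    have "norm (LINT y|lborel. h x y) \<le> (LINT y|lborel. norm (h x y))" by (rule integral_norm_bound)
    also have "\<dots> \<le> (LINT y|lborel. e x y * G y)" by (rule norm_h_le)
    finally have "(norm (LINT y|lborel. h x y))\<^sup>2 \<le> (LINT y|lborel. e x y * G y)\<^sup>2"
      by (intro power_mono) auto
    also have "\<dots> \<le> W * (LINT y|lborel. e x y * (G y)\<^sup>2)"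
      using square_integral_le_weighted[OF e_int(1) eG eG2 e0(1)] e_int(2) by simp
    finally show ?thesis .
  qed
  have col: "(LINT x|lborel. e x y) = W" for y
    using e_int(2)[of y] by (subst e_sym)
  \<comment> \<open>With y as the outer variable the factor in \<open>G\<close> is constant in the
    inner integral, which is then the column integral; the variables are swapped afterwards.\<close>
  have "integrable (lborel \<Otimes>\<^sub>M lborel) (\<lambda>(y, x). e x y * (G y)\<^sup>2)"
  proof (rule lborel_pair.Fubini_integrable)
    show "integrable lborel (\<lambda>y. LINT x|lborel. norm (case (y, x) of (y, x) \<Rightarrow> e x y * (G y)\<^sup>2))"
      using G2 by (simp add: abs_mult e0 col)
    show "AE y in lborel. integrable lborel (\<lambda>x. case (y, x) of (y, x) \<Rightarrow> e x y * (G y)\<^sup>2)"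
      using e_int(1) e_sym by (auto intro!: AE_I2)
  qed measurable
  from lborel_pair.integrable_product_swap[OF this] have pair: "integrable (lborel \<Otimes>\<^sub>M lborel) (\<lambda>(x, y). e x y * (G y)\<^sup>2)"
    by (simp add: case_prod_beta')
  have row: "integrable lborel (\<lambda>x. W * (LINT y|lborel. e x y * (G y)\<^sup>2))"
    using lborel_pair.integrable_fst[OF pair] by simp
  have tot: "(LINT x|lborel. W * (LINT y|lborel. e x y * (G y)\<^sup>2)) = W\<^sup>2 * (LINT y|lborel. (G y)\<^sup>2)"
    using lborel_pair.Fubini_integral[OF pair] by (simp add: col power2_eq_square)
  have hm: "(\<lambda>x. LINT y|lborel. h x y) \<in> borel_measurable lborel"
    using lborel.borel_measurable_lebesgue_integral[of h lborel] h by simp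
  show int: "integrable lborel (\<lambda>x. (norm (LINT y|lborel. h x y))\<^sup>2)"
    by (rule Bochner_Integration.integrable_bound[OF row])
      (use hm in \<open>auto intro!: AE_I2 order_trans[OF sq]\<close>)
  show "(LINT x|lborel. (norm (LINT y|lborel. h x y))\<^sup>2) \<le> W\<^sup>2 * (LINT y|lborel. (G y)\<^sup>2)"
    unfolding tot[symmetric] by (intro integral_mono int row sq)
qed

subsection \<open>Exponential kernels as solutions of a first-order system\<close>

text \<open>The two scalar parts of \<open>Rfree\<close>: this one multiplies \<open>ZZ\<close>, and
  \<open>sgn_exp_abs\<close> multiplies \<open>sigma1\<close>. Off the diagonal, each has i k times
  the other as its derivative in x.\<close>

definition exp_abs :: "complex \<Rightarrow> real \<Rightarrow> real \<Rightarrow> complex" where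
  "exp_abs k x y = exp (\<i> * k * complex_of_real \<bar>x - y\<bar>)"

definition sgn_exp_abs :: "complex \<Rightarrow> real \<Rightarrow> real \<Rightarrow> complex" where
  "sgn_exp_abs k x y = complex_of_real (sgn (x - y)) * exp_abs k x y"

lemma borel_measurable_exp_abs [measurable]:
  "case_prod (exp_abs k) \<in> borel_measurable (lborel \<Otimes>\<^sub>M lborel)"
  "case_prod (sgn_exp_abs k) \<in> borel_measurable (lborel \<Otimes>\<^sub>M lborel)"
  unfolding exp_abs_def sgn_exp_abs_def by measurable

lemma norm_exp_abs: "norm (exp_abs k x y) = exp (- Im k * \<bar>x - y\<bar>)"
  by (simp add: exp_abs_def)

lemma norm_sgn_exp_abs_le: "norm (sgn_exp_abs k x y) \<le> exp (- Im k * \<bar>x - y\<bar>)"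
  by (simp add: sgn_exp_abs_def norm_mult norm_exp_abs sgn_real_def)

lemma set_integrable_const: "set_integrable lborel {a..b::real} (\<lambda>t. B :: 'a::{banach, second_countable_topology})"
  unfolding set_integrable_def by (intro integrable_scaleR_left integrable_real_indicator) (auto simp: emeasure_lborel_Icc_eq)

lemma set_integrable_bounded:
  fixes f :: "real \<Rightarrow> 'a::{banach, second_countable_topology}"
  assumes [measurable]: "f \<in> borel_measurable lborel" and "\<And>t. t \<in> {a..b} \<Longrightarrow> norm (f t) \<le> B"
  shows "set_integrable lborel {a..b} f"
proof (rule set_integrable_bound)
  show "set_integrable lborel {a..b} (\<lambda>t. B)" by (rule set_integrable_const)
  show "set_borel_measurable lborel {a..b} f" unfolding set_borel_measurable_def by measurable
qed (use assms(2) order_trans[OF _ abs_ge_self] in auto)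

text \<open>In the second formula the indicator integrates the point mass 2 at y, the jump of the
  sign. The endpoints are excluded because the sign is 0 there and the full jump would be an
  overcount.\<close>

lemma exp_abs_primitive:
  assumes "a \<le> b"
  shows "exp_abs k b y - exp_abs k a y = (LINT t:{a..b}|lborel. \<i> * k * sgn_exp_abs k t y)" (is ?A)
    and "y \<noteq> a \<Longrightarrow> y \<noteq> b \<Longrightarrow> sgn_exp_abs k b y - sgn_exp_abs k a y
      = (LINT t:{a..b}|lborel. \<i> * k * exp_abs k t y) + 2 * indicator {a..b} y" (is "_ \<Longrightarrow> _ \<Longrightarrow> ?B")
proof -
  define E where "E s = exp (\<i> * k * complex_of_real s)" for s
  \<comment> \<open>\<open>p\<close> and \<open>q\<close> carry the exponential to the right and to
    the left of y and are 1 on the other side. Both are continuous, so the fundamental theorem with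
    the single exceptional point y applies to p + q and p - q, although \<open>sgn_exp_abs\<close>
    itself jumps.\<close>
  define p q where "p t = E (max 0 (t - y))" and "q t = E (max 0 (y - t))" for t
  have e: "exp_abs k t y = p t + q t - 1" for t
    by (auto simp: exp_abs_def p_def q_def E_def max_def)
  have s: "sgn_exp_abs k t y = p t - q t + complex_of_real (sgn (t - y))" for t
    by (auto simp: sgn_exp_abs_def exp_abs_def p_def q_def E_def max_def sgn_real_def)
  have cont: "continuous_on S p" "continuous_on S q" for S
    unfolding p_def q_def E_def by (intro continuous_intros)+
  have E': "((\<lambda>t. E (c * t + d)) has_vector_derivative (\<i> * k * c * E (c * t + d))) (at t)" for c d t :: real
  proof -
    have "((\<lambda>w. exp (\<i> * k * (of_real c * w + of_real d))) has_field_derivative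
        \<i> * k * c * exp (\<i> * k * (of_real c * of_real t + of_real d))) (at (of_real t))"
      by (auto intro!: derivative_eq_intros)
    from has_vector_derivative_real_field[OF this] show ?thesis by (simp add: E_def)
  qed
  have d: "(p has_vector_derivative (if t > y then \<i> * k * p t else 0)) (at t)
      \<and> (q has_vector_derivative (if t > y then 0 else - \<i> * k * q t)) (at t)" if "t \<noteq> y" for t
  proof (cases "t > y")
    case True
    have "(p has_vector_derivative (\<i> * k * E (t - y))) (at t)"
      by (rule has_vector_derivative_transform_within_open[where S="{y<..}", OF E'[of 1 "-y" t, simplified]])
        (use True in \<open>auto simp: p_def max_def\<close>)
    moreover have "(q has_vector_derivative 0) (at t)"
      by (rule has_vector_derivative_transform_within_open[where S="{y<..}" and f="\<lambda>_. 1"])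
        (use True in \<open>auto simp: q_def max_def E_def\<close>)
    ultimately show ?thesis using True by (simp add: p_def)
  next
    case False
    then have t: "t < y" using that by simp
    have "((\<lambda>t. E (y - t)) has_vector_derivative (- \<i> * k * E (y - t))) (at t)"
      using E'[of "-1" y t] by simp
    then have "(q has_vector_derivative (- \<i> * k * E (y - t))) (at t)"
      by (rule has_vector_derivative_transform_within_open[where S="{..<y}"])
        (use t in \<open>auto simp: q_def max_def\<close>)
    moreover have "(p has_vector_derivative 0) (at t)"
      by (rule has_vector_derivative_transform_within_open[where S="{..<y}" and f="\<lambda>_. 1"])
        (use t in \<open>auto simp: p_def max_def E_def\<close>)
    ultimately show ?thesis using t by (simp add: q_def)
  qed
  have pq: "sgn_exp_abs k t y = (if t > y then p t else - q t)"
           "exp_abs k t y = (if t > y then p t else q t)" if "t \<noteq> y" for t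
    using that by (auto simp: sgn_exp_abs_def exp_abs_def p_def q_def E_def max_def)
  have int: "set_integrable lborel {a..b} (\<lambda>t. \<i> * k * sgn_exp_abs k t y)"
            "set_integrable lborel {a..b} (\<lambda>t. \<i> * k * exp_abs k t y)"
  proof -
    \<comment> \<open>Im k may have either sign here; the bound comes from the bounded
      interval.\<close>
    have "exp (- Im k * \<bar>t - y\<bar>) \<le> exp (\<bar>Im k\<bar> * (\<bar>a\<bar> + \<bar>b\<bar> + \<bar>y\<bar>))" if "t \<in> {a..b}" for t
    proof -
      have "- Im k * \<bar>t - y\<bar> \<le> \<bar>Im k\<bar> * \<bar>t - y\<bar>" by (intro mult_right_mono) auto
      also have "\<dots> \<le> \<bar>Im k\<bar> * (\<bar>a\<bar> + \<bar>b\<bar> + \<bar>y\<bar>)" using that by (intro mult_left_mono) auto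
      finally show ?thesis by simp
    qed
    then have "norm (\<i> * k * sgn_exp_abs k t y) \<le> norm k * exp (\<bar>Im k\<bar> * (\<bar>a\<bar> + \<bar>b\<bar> + \<bar>y\<bar>))"
      "norm (\<i> * k * exp_abs k t y) \<le> norm k * exp (\<bar>Im k\<bar> * (\<bar>a\<bar> + \<bar>b\<bar> + \<bar>y\<bar>))" if "t \<in> {a..b}" for t
      using that order_trans[OF norm_sgn_exp_abs_le] unfolding norm_mult norm_ii norm_exp_abs
      by (auto intro!: mult_left_mono)
    then show "set_integrable lborel {a..b} (\<lambda>t. \<i> * k * sgn_exp_abs k t y)"
      "set_integrable lborel {a..b} (\<lambda>t. \<i> * k * exp_abs k t y)"
      by (auto intro!: set_integrable_bounded[where B = "norm k * exp (\<bar>Im k\<bar> * (\<bar>a\<bar> + \<bar>b\<bar> + \<bar>y\<bar>))"])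
  qed
  have "((\<lambda>t. \<i> * k * sgn_exp_abs k t y) has_integral ((p b + q b) - (p a + q a))) {a..b}"
    by (rule fundamental_theorem_of_calculus_interior_strong[of "{y}"])
      (use assms d pq in \<open>auto intro!: continuous_intros cont has_vector_derivative_eq_rhs[OF has_vector_derivative_add]\<close>)
  then have "(LINT t:{a..b}|lborel. \<i> * k * sgn_exp_abs k t y) = (p b + q b) - (p a + q a)"
    unfolding set_borel_integral_eq_integral(2)[OF int(1)] by (rule integral_unique)
  then show ?A
    unfolding e by (simp only:) simp
  assume y: "y \<noteq> a" "y \<noteq> b"
  have "((\<lambda>t. \<i> * k * exp_abs k t y) has_integral ((p b - q b) - (p a - q a))) {a..b}"
    by (rule fundamental_theorem_of_calculus_interior_strong[of "{y}"])
      (use assms d pq in \<open>auto intro!: continuous_intros cont has_vector_derivative_eq_rhs[OF has_vector_derivative_diff]\<close>)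
  then have I: "(LINT t:{a..b}|lborel. \<i> * k * exp_abs k t y) = (p b - q b) - (p a - q a)"
    unfolding set_borel_integral_eq_integral(2)[OF int(2)] by (rule integral_unique)
  show ?B
    unfolding I s using y assms by (auto simp: indicator_def sgn_real_def)
qed

section \<open>Square integrable functions and integration against exponential kernels\<close>

lemma L2_on_UNIV_iff:
  "L2_on UNIV f \<longleftrightarrow> f \<in> borel_measurable lborel \<and> integrable lborel (\<lambda>x. (norm (f x))\<^sup>2)"
  by (simp add: L2_on_def)

lemma L2_on_subset:
  assumes "L2_on UNIV f" and [measurable]: "S \<in> sets borel"
  shows "L2_on S f"
proof -
  have [measurable]: "f \<in> borel_measurable lborel" and int: "integrable lborel (\<lambda>x. (norm (f x))\<^sup>2)"
    using assms by (auto simp: L2_on_UNIV_iff)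
  have "integrable lborel (\<lambda>x. indicator S x * (norm (f x))\<^sup>2)"
    by (rule Bochner_Integration.integrable_bound[OF int]) (auto simp: indicator_def)
  then show ?thesis by (simp add: L2_on_def)
qed

lemma L2_on_set_integrable:
  assumes "L2_on UNIV f"
  shows "set_integrable lborel {a..b} f"
proof (rule set_integrable_bound)
  have [measurable]: "f \<in> borel_measurable lborel" and int: "integrable lborel (\<lambda>x. (norm (f x))\<^sup>2)"
    using assms by (auto simp: L2_on_UNIV_iff)
  have "set_integrable lborel {a..b} (\<lambda>x. (norm (f x))\<^sup>2)"
    unfolding set_integrable_def by (rule Bochner_Integration.integrable_bound[OF int]) (auto simp: indicator_def)
  then show "set_integrable lborel {a..b} (\<lambda>x. 1 + (norm (f x))\<^sup>2)"
    by (intro set_integral_add set_integrable_const)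
  show "set_borel_measurable lborel {a..b} f" unfolding set_borel_measurable_def by measurable
  have "t \<le> 1 + t\<^sup>2" for t :: real
    using zero_le_power2[of "t - 1/2"] by (simp add: power2_diff field_simps)
  then show "AE x in lborel. x \<in> {a..b} \<longrightarrow> norm (f x) \<le> norm (1 + (norm (f x))\<^sup>2)"
    by (auto simp: abs_of_nonneg add_nonneg_nonneg)
qed

text \<open>Prepares the integration of \<open>exp_abs_primitive\<close> against \<open>g\<close>.
  Joint integrability over a bounded interval times the line holds because the inner absolute
  integrals are bounded uniformly in t.\<close>

lemma Fubini_exp_kernel:
  fixes K :: "real \<Rightarrow> real \<Rightarrow> complex"
  assumes K [measurable]: "case_prod K \<in> borel_measurable (lborel \<Otimes>\<^sub>M lborel)"
    and \<kappa>: "\<kappa> > 0" and bound: "\<And>x y. norm (K x y) \<le> exp (- \<kappa> * \<bar>x - y\<bar>)"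
    and g: "L2_on UNIV g"
  shows "integrable lborel (\<lambda>y. K x y *s g y)"
    and "L2_on UNIV (\<lambda>x. LINT y|lborel. K x y *s g y)"
    and "(LINT y|lborel. (LINT t:{a..b}|lborel. K t y) *s g y)
      = (LINT t:{a..b}|lborel. LINT y|lborel. K t y *s g y)"
    and "integrable lborel (\<lambda>y. (LINT t:{a..b}|lborel. K t y) *s g y)"
proof -
  have [measurable]: "g \<in> borel_measurable lborel" and g2: "integrable lborel (\<lambda>x. (norm (g x))\<^sup>2)"
    using g by (auto simp: L2_on_UNIV_iff)
  define h where "h x y = K x y *s g y" for x y
  have h [measurable]: "case_prod h \<in> borel_measurable (lborel \<Otimes>\<^sub>M lborel)"
    unfolding h_def by measurable
  have hb: "norm (h x y) \<le> exp (- \<kappa> * \<bar>x - y\<bar>) * norm (g y)" for x y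
    unfolding h_def norm_vector_scalar_mult by (intro mult_right_mono bound) auto
  have gm: "(\<lambda>y. norm (g y)) \<in> borel_measurable lborel" by measurable
  note ek = exp_kernel[OF h \<kappa> hb gm g2]
  have Km: "(\<lambda>t. K t y) \<in> borel_measurable lborel" for y by measurable
  have Ki: "set_integrable lborel {a..b} (\<lambda>t. K t y)" for y
    using \<kappa> by (auto intro!: set_integrable_bounded[where B=1] order_trans[OF bound])
  show "integrable lborel (\<lambda>y. K x y *s g y)" using ek(1)[of x] by (simp add: h_def[abs_def])
  have "(\<lambda>x. LINT y|lborel. h x y) \<in> borel_measurable lborel"
    using lborel.borel_measurable_lebesgue_integral[of h lborel] h by simp
  then show "L2_on UNIV (\<lambda>x. LINT y|lborel. K x y *s g y)"
    using ek(3) by (simp add: L2_on_UNIV_iff h_def)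
  have pull: "(LINT t|lborel. indicator {a..b} t *\<^sub>R h t y) = (LINT t:{a..b}|lborel. K t y) *s g y" for y
    using integral_bounded_linear[OF bounded_bilinear.bounded_linear_left[OF bounded_bilinear_vector_scalar_mult, of "g y"] Ki[of y, unfolded set_integrable_def]]
    by (simp add: set_lebesgue_integral_def h_def
        bounded_bilinear.scaleR_left[OF bounded_bilinear_vector_scalar_mult])
  define B where "B = (LINT t|lborel. exp (- \<kappa> * \<bar>t\<bar>)) + (LINT y|lborel. (norm (g y))\<^sup>2)"
  have pair: "integrable (lborel \<Otimes>\<^sub>M lborel) (\<lambda>(t, y). indicator {a..b} t *\<^sub>R h t y)"
  proof (rule lborel_pair.Fubini_integrable)
    have "set_integrable lborel {a..b} (\<lambda>t. LINT y|lborel. norm (h t y))"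
    proof (rule set_integrable_bounded)
      show "norm (LINT y|lborel. norm (h t y)) \<le> B" for t
        using ek(2)[of t] by (simp add: B_def)
      show "(\<lambda>t. LINT y|lborel. norm (h t y)) \<in> borel_measurable lborel"
        by (rule lborel.borel_measurable_lebesgue_integral) measurable
    qed
    then show "integrable lborel (\<lambda>t. LINT y|lborel. norm (case (t, y) of (t, y) \<Rightarrow> indicator {a..b} t *\<^sub>R h t y))"
      by (simp add: set_integrable_def)
    show "AE t in lborel. integrable lborel (\<lambda>y. case (t, y) of (t, y) \<Rightarrow> indicator {a..b} t *\<^sub>R h t y)"
      using ek(1) by auto
  qed measurable
  show "(LINT y|lborel. (LINT t:{a..b}|lborel. K t y) *s g y)
      = (LINT t:{a..b}|lborel. LINT y|lborel. K t y *s g y)"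
    using lborel_pair.Fubini_integral[OF pair]
    by (simp add: pull set_lebesgue_integral_def) (simp add: h_def)
  show "integrable lborel (\<lambda>y. (LINT t:{a..b}|lborel. K t y) *s g y)"
    using lborel_pair.integrable_snd[OF pair] by (simp add: pull)
qed

lemma set_integral_bounded_linear:
  fixes f :: "'m \<Rightarrow> 'a::{banach, second_countable_topology}"
    and T :: "'a \<Rightarrow> 'b::{banach, second_countable_topology}"
  assumes T: "bounded_linear T" and f: "set_integrable M S f"
  shows "set_integrable M S (\<lambda>x. T (f x))"
    and "(LINT x:S|M. T (f x)) = T (LINT x:S|M. f x)"
proof -
  interpret bounded_linear T by fact
  show "set_integrable M S (\<lambda>x. T (f x))"
    using integrable_bounded_linear[OF T f[unfolded set_integrable_def]]
    by (simp add: set_integrable_def scaleR)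
  show "(LINT x:S|M. T (f x)) = T (LINT x:S|M. f x)"
    using integral_bounded_linear[OF T f[unfolded set_integrable_def]]
    by (simp add: set_lebesgue_integral_def scaleR)
qed

lemmas bounded_linear_matrix_vector_mult =
  bounded_bilinear.bounded_linear_right[OF bounded_bilinear_matrix_vector_mult]
lemmas bounded_linear_vector_scalar_mult =
  bounded_bilinear.bounded_linear_right[OF bounded_bilinear_vector_scalar_mult]

lemma L2_on_add:
  assumes "L2_on UNIV f" "L2_on UNIV g"
  shows "L2_on UNIV (\<lambda>x. f x + g x)"
proof -
  have [measurable]: "f \<in> borel_measurable lborel" "g \<in> borel_measurable lborel"
    and i: "integrable lborel (\<lambda>x. (norm (f x))\<^sup>2)" "integrable lborel (\<lambda>x. (norm (g x))\<^sup>2)"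
    using assms by (auto simp: L2_on_UNIV_iff)
  have b: "(norm (f x + g x))\<^sup>2 \<le> 2 * (norm (f x))\<^sup>2 + 2 * (norm (g x))\<^sup>2" for x
  proof -
    have "(norm (f x + g x))\<^sup>2 \<le> (norm (f x) + norm (g x))\<^sup>2"
      by (intro power_mono norm_triangle_ineq) auto
    also have "\<dots> \<le> 2 * (norm (f x))\<^sup>2 + 2 * (norm (g x))\<^sup>2"
      using zero_le_power2[of "norm (f x) - norm (g x)"] by (simp add: power2_diff power2_sum)
    finally show ?thesis .
  qed
  have "integrable lborel (\<lambda>x. 2 * (norm (f x))\<^sup>2 + 2 * (norm (g x))\<^sup>2)" using i by auto
  then have "integrable lborel (\<lambda>x. (norm (f x + g x))\<^sup>2)"
    by (rule Bochner_Integration.integrable_bound) (use b in \<open>auto simp: abs_of_nonneg add_nonneg_nonneg\<close>)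
  then show ?thesis by (simp add: L2_on_UNIV_iff)
qed

lemma L2_on_bounded_linear:
  assumes T: "bounded_linear T" and "L2_on UNIV f"
  shows "L2_on UNIV (\<lambda>x. T (f x))"
proof -
  have [measurable]: "f \<in> borel_measurable lborel" and i: "integrable lborel (\<lambda>x. (norm (f x))\<^sup>2)"
    using assms by (auto simp: L2_on_UNIV_iff)
  have [measurable]: "T \<in> borel_measurable borel"
    using T by (intro borel_measurable_continuous_onI linear_continuous_on)
  obtain K where K: "norm (T v) \<le> norm v * K" for v
    using bounded_linear.bounded[OF T] by blast
  have "(norm (T v))\<^sup>2 \<le> (norm v)\<^sup>2 * K\<^sup>2" for v
    unfolding power_mult_distrib[symmetric] by (intro power_mono K) auto
  moreover have "integrable lborel (\<lambda>x. (norm (f x))\<^sup>2 * K\<^sup>2)" using i by auto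
  ultimately have "integrable lborel (\<lambda>x. (norm (T (f x)))\<^sup>2)"
    by (elim Bochner_Integration.integrable_bound) (auto intro!: AE_I2)
  then show ?thesis by (simp add: L2_on_UNIV_iff)
qed

lemma L2_on_diff:
  assumes "L2_on UNIV f" "L2_on UNIV g"
  shows "L2_on UNIV (\<lambda>x. f x - g x)"
  using L2_on_add[OF assms(1) L2_on_bounded_linear[OF bounded_linear_minus[OF bounded_linear_ident] assms(2)]]
  by simp

text \<open>This is \<open>exp_abs_primitive\<close> integrated against \<open>g\<close>, an
  integral form of F' = i k G and G' = i k F + 2 g. The point mass on the diagonal becomes the term
  2 g.\<close>

lemma exp_abs_convolution:
  assumes k: "Im k > 0" and g: "L2_on UNIV g" and ab: "a \<le> b"
  defines "F \<equiv> \<lambda>x. LINT y|lborel. exp_abs k x y *s g y"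
    and "G \<equiv> \<lambda>x. LINT y|lborel. sgn_exp_abs k x y *s g y"
  shows "F b - F a = (LINT t:{a..b}|lborel. (\<i> * k) *s G t)"
    and "G b - G a = (LINT t:{a..b}|lborel. (\<i> * k) *s F t + 2 *s g t)"
proof -
  note e = Fubini_exp_kernel[OF borel_measurable_exp_abs(1) k eq_refl[OF norm_exp_abs] g]
  note s = Fubini_exp_kernel[OF borel_measurable_exp_abs(2) k norm_sgn_exp_abs_le g]
  have [measurable]: "g \<in> borel_measurable lborel" using g by (simp add: L2_on_UNIV_iff)
  note Lin = bounded_linear_vector_scalar_mult
  have "F b - F a = (LINT y|lborel. exp_abs k b y *s g y - exp_abs k a y *s g y)"
    using e(1) by (simp add: F_def)
  also have "\<dots> = (LINT y|lborel. (\<i> * k) *s ((LINT t:{a..b}|lborel. sgn_exp_abs k t y) *s g y))"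
    using exp_abs_primitive(1)[OF ab, of k]
    by (intro Bochner_Integration.integral_cong)
      (auto simp: vector_sub_rdistrib[symmetric] vec_eq_iff simp flip: left_diff_distrib)
  also have "\<dots> = (\<i> * k) *s (LINT t:{a..b}|lborel. G t)"
    using integral_bounded_linear[OF Lin s(4)] s(3) by (simp add: G_def)
  also have "\<dots> = (LINT t:{a..b}|lborel. (\<i> * k) *s G t)"
    using set_integral_bounded_linear(2)[OF Lin L2_on_set_integrable[OF s(2)]] by (simp add: G_def)
  finally show "F b - F a = (LINT t:{a..b}|lborel. (\<i> * k) *s G t)" .
  have gi: "integrable lborel (\<lambda>y. indicator {a..b} y *\<^sub>R g y)"
    using L2_on_set_integrable[OF g] by (simp add: set_integrable_def)
  have "G b - G a = (LINT y|lborel. sgn_exp_abs k b y *s g y - sgn_exp_abs k a y *s g y)"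
    using s(1) by (simp add: G_def)
  also have "\<dots> = (LINT y|lborel. (\<i> * k) *s ((LINT t:{a..b}|lborel. exp_abs k t y) *s g y)
      + 2 *s (indicator {a..b} y *\<^sub>R g y))"
  proof (rule integral_cong_AE)
    \<comment> \<open>The endpoints excluded in \<open>exp_abs_primitive\<close> form a null set in
      y.\<close>
    have "AE y in lborel. y \<noteq> a \<and> y \<noteq> b" using AE_lborel_singleton[of a] AE_lborel_singleton[of b] by eventually_elim simp
    then show "AE y in lborel. sgn_exp_abs k b y *s g y - sgn_exp_abs k a y *s g y
        = (\<i> * k) *s ((LINT t:{a..b}|lborel. exp_abs k t y) *s g y) + 2 *s (indicator {a..b} y *\<^sub>R g y)"
    proof eventually_elim
      case (elim y)
      then have "sgn_exp_abs k b y = sgn_exp_abs k a y + (\<i> * k * (LINT t:{a..b}|lborel. exp_abs k t y) + 2 * indicator {a..b} y)"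
        using exp_abs_primitive(2)[OF ab, of y k] by (simp add: algebra_simps)
      then show ?case by (auto simp: vec_eq_iff algebra_simps indicator_def)
    qed
  next
    show "(\<lambda>y. sgn_exp_abs k b y *s g y - sgn_exp_abs k a y *s g y) \<in> borel_measurable lborel"
      using s(1) by (intro borel_measurable_diff borel_measurable_integrable) auto
    show "(\<lambda>y. (\<i> * k) *s ((LINT t:{a..b}|lborel. exp_abs k t y) *s g y) + 2 *s (indicator {a..b} y *\<^sub>R g y)) \<in> borel_measurable lborel"
      using integrable_bounded_linear[OF Lin e(4)[of a b]] integrable_bounded_linear[OF Lin gi]
      by (intro borel_measurable_add borel_measurable_integrable) auto
  qed
  also have "\<dots> = (\<i> * k) *s (LINT t:{a..b}|lborel. F t) + 2 *s (LINT t:{a..b}|lborel. g t)"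
    using integral_bounded_linear[OF Lin e(4)] integrable_bounded_linear[OF Lin e(4)] e(3)
      integral_bounded_linear[OF Lin gi] integrable_bounded_linear[OF Lin gi]
    by (simp add: F_def set_lebesgue_integral_def)
  also have "\<dots> = (LINT t:{a..b}|lborel. (\<i> * k) *s F t + 2 *s g t)"
    using set_integral_bounded_linear[OF Lin L2_on_set_integrable[OF e(2)]]
      set_integral_bounded_linear[OF Lin L2_on_set_integrable[OF g]]
    by (simp add: F_def set_integral_add)
  finally show "G b - G a = (LINT t:{a..b}|lborel. (\<i> * k) *s F t + 2 *s g t)" .
qed

subsection \<open>The free resolvent\<close>

text \<open>The definite description is well defined: a real root would make w a nonnegative real,
  and of two opposite nonreal roots exactly one lies in the upper half plane.\<close>

lemma sqrt_im_pos:
  assumes "w \<notin> complex_of_real ` {0..}"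
  shows "(sqrt_im_pos w)\<^sup>2 = w" and "Im (sqrt_im_pos w) > 0"
proof -
  have nz: "Im s \<noteq> 0" if "s\<^sup>2 = w" for s
  proof
    assume "Im s = 0"
    then have "w = complex_of_real ((Re s)\<^sup>2)"
      using that by (simp add: complex_eq_iff power2_eq_square)
    then show False using assms by (auto intro: image_eqI[of _ _ "(Re s)\<^sup>2"])
  qed
  have "\<exists>!s. s\<^sup>2 = w \<and> Im s > 0"
  proof (rule ex_ex1I)
    obtain s where s: "s\<^sup>2 = w" using power2_csqrt by blast
    show "\<exists>s. s\<^sup>2 = w \<and> Im s > 0"
    proof (cases "Im s > 0")
      case False
      then have "Im (- s) > 0" using nz[OF s] by simp
      moreover have "(- s)\<^sup>2 = w" using s by simp
      ultimately show ?thesis by blast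
    qed (use s in blast)
  next
    fix s t assume "s\<^sup>2 = w \<and> Im s > 0" "t\<^sup>2 = w \<and> Im t > 0"
    moreover from this have "s = t \<or> s = - t" by (simp flip: power2_eq_iff)
    ultimately show "s = t" by (elim disjE) simp_all
  qed
  from theI'[OF this] show "(sqrt_im_pos w)\<^sup>2 = w" "Im (sqrt_im_pos w) > 0"
    by (auto simp: sqrt_im_pos_def)
qed

lemmas cmat_vec_simps = vec_eq_iff forall_2 sum_2 matrix_vector_mult_def matrix_matrix_mult_def
  cmat_scale_def ZZ_def sigma0_def sigma1_def sigma3_def mat_def

text \<open>Solving \<open>-i sigma1 \<psi>' + m sigma3 \<psi> = z \<psi>\<close> for the derivative gives
  \<open>\<psi>' = Dirac_ode m z *v \<psi>\<close>.\<close>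

definition Dirac_ode :: "real \<Rightarrow> complex \<Rightarrow> cmat" where
  "Dirac_ode m z = vector [vector [0, \<i> * (z + complex_of_real m)], vector [\<i> * (z - complex_of_real m), 0]]"

locale gap_point =
  fixes m :: real and z :: complex
  assumes z_dom: "z \<notin> complex_of_real ` ({..- \<bar>m\<bar>} \<union> {\<bar>m\<bar>..})"
begin

abbreviation "k \<equiv> kk m z"
abbreviation "\<zeta> \<equiv> zeta m z"

text \<open>If the radicand were a real r with r \<ge> 0, then z would be one of the two real roots
  of r + m^2, whose modulus is at least that of m; these lie on the excluded rays.\<close>

lemma kk: "k\<^sup>2 = z\<^sup>2 - (complex_of_real m)\<^sup>2" "Im k > 0"
proof -
  have "z\<^sup>2 - (complex_of_real m)\<^sup>2 \<notin> complex_of_real ` {0..}"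
  proof
    assume "z\<^sup>2 - (complex_of_real m)\<^sup>2 \<in> complex_of_real ` {0..}"
    then obtain r where r: "r \<ge> 0" "z\<^sup>2 = complex_of_real (r + m\<^sup>2)" by (auto simp: algebra_simps)
    define s where "s = sqrt (r + m\<^sup>2)"
    have "s\<^sup>2 = r + m\<^sup>2" using r by (simp add: s_def)
    then have "z\<^sup>2 = (complex_of_real s)\<^sup>2" using r(2) by (metis of_real_power)
    then have "z = complex_of_real s \<or> z = complex_of_real (- s)" by (auto simp: power2_eq_iff)
    moreover have "\<bar>m\<bar> \<le> s" unfolding s_def using r by (intro real_le_rsqrt) auto
    ultimately show False using z_dom by auto
  qed
  from sqrt_im_pos[OF this] show "k\<^sup>2 = z\<^sup>2 - (complex_of_real m)\<^sup>2" "Im k > 0" by (auto simp: kk_def)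
qed

lemma k_nz: "k \<noteq> 0" using kk(2) by auto

lemma zeta_k: "\<zeta> * k = z + complex_of_real m"
  using k_nz by (simp add: zeta_def)

lemma zeta_nz: "\<zeta> \<noteq> 0"
proof -
  have "complex_of_real (- m) \<in> complex_of_real ` ({..- \<bar>m\<bar>} \<union> {\<bar>m\<bar>..})"
    by (intro imageI) (auto simp: abs_if)
  then have "z \<noteq> - complex_of_real m" using z_dom by auto
  then show ?thesis using k_nz by (auto simp: zeta_def eq_neg_iff_add_eq_0)
qed

text \<open>From (z - m)(z + m) = k^2. Together with \<open>zeta_k\<close> this eliminates z from
  \<open>Dirac_ode\<close> in favour of \<open>\<zeta>\<close> and \<open>k\<close>.\<close>

lemma inverse_zeta_k: "inverse \<zeta> * k = z - complex_of_real m"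
proof -
  have "(z - complex_of_real m) * (\<zeta> * k) = k * k"
    unfolding zeta_k using kk(1) by (simp add: power2_eq_square algebra_simps)
  then have "(z - complex_of_real m) * \<zeta> = k" using k_nz by simp
  then show ?thesis using zeta_nz by (auto simp: field_simps)
qed

lemma Rfree_mult:
  "Rfree m z x y *v v = cmat_scale (\<i> / 2) (ZZ m z) *v (exp_abs k x y *s v)
     + cmat_scale (\<i> / 2) sigma1 *v (sgn_exp_abs k x y *s v)"
  by (simp add: cmat_vec_simps Rfree_def exp_abs_def sgn_exp_abs_def algebra_simps)

text \<open>Encodes \<open>Dirac_ode\<close> times \<open>ZZ\<close> = i k \<open>sigma1\<close> and
  \<open>Dirac_ode\<close> times \<open>sigma1\<close> = i k \<open>ZZ\<close>. Here v and w stand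
  for the convolutions with \<open>exp_abs\<close> and \<open>sgn_exp_abs\<close>, and u for the
  source.\<close>

lemma Dirac_ode_mult:
  "cmat_scale (\<i> / 2) (ZZ m z) *v ((\<i> * k) *s w) + cmat_scale (\<i> / 2) sigma1 *v ((\<i> * k) *s v + 2 *s u)
   = Dirac_ode m z *v (cmat_scale (\<i> / 2) (ZZ m z) *v v + cmat_scale (\<i> / 2) sigma1 *v w)
     + cmat_scale \<i> sigma1 *v u"
proof -
  \<comment> \<open>\<open>algebra\<close> treats the inverse as an independent unknown, so its
    defining relation is supplied.\<close>
  have "\<zeta> * inverse \<zeta> = 1" using zeta_nz by simp
  then show ?thesis
    unfolding Dirac_ode_def zeta_k[symmetric] inverse_zeta_k[symmetric]
    by (simp add: cmat_vec_simps algebra_simps) algebra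
qed

definition free_res :: "(real \<Rightarrow> cvec) \<Rightarrow> real \<Rightarrow> cvec" where
  "free_res f x = (LINT y|lborel. Rfree m z x y *v f y)"

text \<open>The differential equation is stated in integrated form at every pair of points, also
  across the origin. Hence \<open>free_res f 0\<close> is the trace from both sides.\<close>

lemma free_res:
  assumes f: "L2_on UNIV f"
  shows integrable_Rfree: "integrable lborel (\<lambda>y. Rfree m z x y *v f y)"
    and L2_on_free_res: "L2_on UNIV (free_res f)"
    and free_res_ode: "a \<le> b \<Longrightarrow> free_res f b - free_res f a
      = (LINT t:{a..b}|lborel. Dirac_ode m z *v free_res f t + cmat_scale \<i> sigma1 *v f t)"
proof -
  note e = Fubini_exp_kernel[OF borel_measurable_exp_abs(1) kk(2) eq_refl[OF norm_exp_abs] f]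
  note s = Fubini_exp_kernel[OF borel_measurable_exp_abs(2) kk(2) norm_sgn_exp_abs_le f]
  note Lin = bounded_linear_matrix_vector_mult bounded_linear_vector_scalar_mult
  define P Q where "P = cmat_scale (\<i> / 2) (ZZ m z)" and "Q = cmat_scale (\<i> / 2) sigma1"
  define F G where "F x = (LINT y|lborel. exp_abs k x y *s f y)"
    and "G x = (LINT y|lborel. sgn_exp_abs k x y *s f y)" for x
  have res: "free_res f x = P *v F x + Q *v G x" for x
    unfolding free_res_def Rfree_mult F_def G_def P_def Q_def
    using integrable_bounded_linear[OF Lin(1) e(1)] integrable_bounded_linear[OF Lin(1) s(1)]
      integral_bounded_linear[OF Lin(1) e(1)] integral_bounded_linear[OF Lin(1) s(1)]
    by simp
  show "integrable lborel (\<lambda>y. Rfree m z x y *v f y)"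
    unfolding Rfree_mult
    using integrable_bounded_linear[OF Lin(1) e(1)] integrable_bounded_linear[OF Lin(1) s(1)] by simp
  have L2: "L2_on UNIV F" "L2_on UNIV G"
    unfolding F_def[abs_def] G_def[abs_def] by (rule e(2) s(2))+
  have "L2_on UNIV (\<lambda>x. P *v F x + Q *v G x)"
    by (rule L2_on_add[OF L2_on_bounded_linear[OF Lin(1) L2(1)] L2_on_bounded_linear[OF Lin(1) L2(2)]])
  then show "L2_on UNIV (free_res f)" unfolding res[abs_def] .
  assume ab: "a \<le> b"
  have iG: "set_integrable lborel {a..b} (\<lambda>t. (\<i> * k) *s G t)"
    and iF: "set_integrable lborel {a..b} (\<lambda>t. (\<i> * k) *s F t + 2 *s f t)"
    by (rule L2_on_set_integrable L2_on_add L2_on_bounded_linear[OF Lin(2)] L2 f)+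
  have "free_res f b - free_res f a = P *v (F b - F a) + Q *v (G b - G a)"
    unfolding res matrix_vector_mult_diff_distrib by (simp only: add_diff_add)
  also have "\<dots> = (LINT t:{a..b}|lborel. P *v ((\<i> * k) *s G t))
      + (LINT t:{a..b}|lborel. Q *v ((\<i> * k) *s F t + 2 *s f t))"
    unfolding exp_abs_convolution[OF kk(2) f ab, folded F_def G_def]
      set_integral_bounded_linear(2)[OF Lin(1) iG] set_integral_bounded_linear(2)[OF Lin(1) iF] ..
  also have "\<dots> = (LINT t:{a..b}|lborel. P *v ((\<i> * k) *s G t) + Q *v ((\<i> * k) *s F t + 2 *s f t))"
    by (rule set_integral_add(2)[OF set_integral_bounded_linear(1)[OF Lin(1) iG]
          set_integral_bounded_linear(1)[OF Lin(1) iF], symmetric])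
  also have "\<dots> = (LINT t:{a..b}|lborel. Dirac_ode m z *v free_res f t + cmat_scale \<i> sigma1 *v f t)"
    unfolding res P_def Q_def Dirac_ode_mult ..
  finally show "free_res f b - free_res f a
      = (LINT t:{a..b}|lborel. Dirac_ode m z *v free_res f t + cmat_scale \<i> sigma1 *v f t)" .
qed

end

subsection \<open>Square integrable solutions on a half line\<close>

text \<open>An integrating factor solves the equation for the continuous representative
  \<open>U\<close>; \<open>u\<close> itself is only controlled almost everywhere.\<close>

lemma linear_ode_AE:
  fixes u u' :: "real \<Rightarrow> complex"
  assumes int: "\<And>x. x > 0 \<Longrightarrow> set_integrable lborel {0..x} u'"
    and u: "AE x in lborel. x > 0 \<longrightarrow> u x = c + (LINT t:{0..x}|lborel. u' t)"
    and ode: "AE x in lborel. x > 0 \<longrightarrow> u' x = l * u x"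
  shows "AE x in lborel. x > 0 \<longrightarrow> u x = c * exp (l * complex_of_real x)"
proof -
  define U where "U x = c + (LINT t:{0..x}|lborel. u' t)" for x
  have cont: "continuous_on {0..X} U" if "X > 0" for X
  proof -
    have "continuous_on {0..X} (\<lambda>x. c + integral {0..x} u')"
      by (intro continuous_intros indefinite_integral_continuous_1 set_borel_integral_eq_integral(1) int that)
    moreover have "U x = c + integral {0..x} u'" if "x \<in> {0..X}" for x
    proof -
      have "set_integrable lborel {0..x} u'"
        by (rule set_integrable_subset[OF int[OF \<open>X > 0\<close>]]) (use that in auto)
      then show ?thesis by (simp add: U_def set_borel_integral_eq_integral(2))
    qed
    ultimately show ?thesis by (rule continuous_on_eq[OF _ sym])
  qed
  have U: "U x = c + integral {0..x} (\<lambda>t. l * U t)" if x: "x > 0" for x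
  proof -
    have c: "continuous_on {0..x} (\<lambda>t. l * U t)" by (intro continuous_intros cont x)
    have "(LINT t:{0..x}|lborel. u' t) = (LINT t:{0..x}|lborel. l * U t)"
      unfolding set_lebesgue_integral_def
    proof (rule integral_cong_AE)
      show "(\<lambda>t. indicator {0..x} t *\<^sub>R u' t) \<in> borel_measurable lborel"
        using int[OF x] by (auto simp: set_integrable_def)
      show "(\<lambda>t. indicator {0..x} t *\<^sub>R (l * U t)) \<in> borel_measurable lborel"
        using borel_measurable_continuous_on_indicator[OF _ c] by simp
      show "AE t in lborel. indicator {0..x} t *\<^sub>R u' t = indicator {0..x} t *\<^sub>R (l * U t)"
        using ode u AE_lborel_singleton[of 0]
        by eventually_elim (auto simp: indicator_def U_def)
    qed
    also have "\<dots> = integral {0..x} (\<lambda>t. l * U t)"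
      by (rule set_borel_integral_eq_integral(2)[OF borel_integrable_atLeastAtMost'[OF c]])
    finally show ?thesis by (simp add: U_def)
  qed
  have U0: "U 0 = c"
  proof -
    have "set_integrable lborel {0..0} u'"
      by (rule set_integrable_subset[OF int[of 1]]) auto
    from set_borel_integral_eq_integral(2)[OF this] show ?thesis by (simp add: U_def)
  qed
  have sol: "U x = c * exp (l * complex_of_real x)" if x: "x > 0" for x
  proof -
    \<comment> \<open>\<open>V\<close> uses the integral expression for \<open>U\<close>, whose
      integrand is continuous, so that it can be differentiated classically.\<close>
    define V where "V t = exp (- l * complex_of_real t) * (c + integral {0..t} (\<lambda>t. l * U t))" for t
    have "(V has_vector_derivative 0) (at t within {0..x})" if t: "t \<in> {0..x}" for t
    proof -
      have c: "continuous_on {0..x} (\<lambda>t. l * U t)" by (intro continuous_intros cont x)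
      have e: "((\<lambda>t. exp (- l * complex_of_real t)) has_vector_derivative (- l * exp (- l * complex_of_real t))) (at t within {0..x})"
        by (rule has_vector_derivative_real_field) (auto intro!: derivative_eq_intros)
      have "((\<lambda>t. c + integral {0..t} (\<lambda>t. l * U t)) has_vector_derivative (0 + l * U t)) (at t within {0..x})"
        by (intro has_vector_derivative_add has_vector_derivative_const integral_has_vector_derivative c t)
      then have "(V has_vector_derivative (exp (- l * complex_of_real t) * (0 + l * U t)
          + (- l * exp (- l * complex_of_real t)) * (c + integral {0..t} (\<lambda>t. l * U t)))) (at t within {0..x})"
        unfolding V_def by (intro has_vector_derivative_mult e)
      moreover have "U t = c + integral {0..t} (\<lambda>t. l * U t)"
        using U[of t] U0 t by (cases "t = 0") auto
      ultimately show ?thesis by (simp add: algebra_simps)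
    qed
    then obtain d where "\<And>t. t \<in> {0..x} \<Longrightarrow> V t = d"
      using has_vector_derivative_zero_constant[of "{0..x}" V] by auto
    then have "V x = V 0" using x by auto
    then have "exp (- l * complex_of_real x) * U x = c" using U[OF x] by (simp add: V_def)
    then show ?thesis by (simp add: exp_minus field_simps)
  qed
  show ?thesis using u by eventually_elim (use sol in \<open>auto simp: U_def\<close>)
qed

text \<open>The modulus of u is at least that of c almost everywhere on a half line of infinite
  measure. The majorant \<open>g\<close> lets u be a component of a vector-valued function.\<close>

lemma exp_growth_not_L2:
  fixes u :: "real \<Rightarrow> complex"
  assumes u: "AE x in lborel. x > 0 \<longrightarrow> u x = c * exp (l * complex_of_real x)"
    and l: "Re l \<ge> 0" and g: "integrable lborel (\<lambda>x. indicator {0<..} x * g x)"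
    and bound: "\<And>x. (norm (u x))\<^sup>2 \<le> g x"
  shows "c = 0"
proof (rule ccontr)
  assume c: "c \<noteq> 0"
  have "integrable lborel (\<lambda>x::real. indicator {0<..} x * (norm c)\<^sup>2)"
  proof (rule Bochner_Integration.integrable_bound[OF g])
    show "AE x in lborel. norm (indicator {0<..} x * (norm c)\<^sup>2) \<le> norm (indicator {0<..} x * g x)"
      using u
    proof eventually_elim
      case (elim x)
      show ?case
      proof (cases "x > 0")
        case True
        have "(norm c)\<^sup>2 \<le> (norm (u x))\<^sup>2"
          using elim True l by (auto simp: norm_mult intro!: power_mono mult_right_le_one_le mult_le_cancel_left1[THEN iffD2])
        also have "\<dots> \<le> \<bar>g x\<bar>" using bound[of x] by simp
        finally show ?thesis using True by simp
      qed simp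
    qed
  qed measurable
  then have "integrable lborel (indicator {0::real<..} :: real \<Rightarrow> real)" using c by simp
  then have "emeasure lborel {0::real<..} < \<infinity>" by (simp add: integrable_indicator_iff)
  moreover have "emeasure lborel {0::real<..} = \<infinity>"
  proof -
    have "ennreal (real n) \<le> emeasure lborel {0::real<..}" for n
    proof -
      have "{0<..<real n} \<subseteq> {0<..}" by auto
      from emeasure_mono[OF this, of lborel] show ?thesis by simp
    qed
    then show ?thesis using ennreal_SUP_of_nat_eq_top by (metis SUP_least top.extremum_unique infinity_ennreal_def ennreal_of_nat_eq_real_of_nat)
  qed
  ultimately show False by simp
qed

text \<open>The reflection is applied to a measurable null set covering the exceptions, since
  \<open>P\<close> need not be measurable.\<close>

lemma AE_lborel_reflect:
  assumes "AE x in lborel. P (x :: real)"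
  shows "AE x in lborel. P (- x)"
proof -
  obtain N where N: "N \<in> null_sets lborel" "{x. \<not> P x} \<subseteq> N"
    using assms by (auto simp: eventually_ae_filter)
  have "AE x in lborel. x \<notin> N" using N(1) by (rule AE_not_in)
  moreover have [measurable]: "N \<in> sets borel" using N(1) by auto
  ultimately have "AE x in lborel. 0 + - 1 * x \<notin> N" by (intro AE_borel_affine) auto
  then show ?thesis by eventually_elim (use N(2) in auto)
qed

text \<open>Reduces the left half line to the right one, so that decay is studied only once.\<close>

lemma H1L_reflect:
  assumes "H1L f c f'"
  shows "H1R (\<lambda>x. f (- x)) c (\<lambda>x. - f' (- x))"
proof -
  have L2: "L2_on {0<..} (\<lambda>x. h (- x))" if "L2_on {..<0} h" for h
  proof -
    have i: "indicator {..<0} (- x) = (indicator {0<..} x :: real)" for x :: real by (simp add: indicator_def)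
    have "(\<lambda>x. indicator {..<0} (- x) *\<^sub>R h (- x)) \<in> borel_measurable lborel"
      using that measurable_compose[of uminus borel borel] by (fastforce simp: L2_on_def)
    then show ?thesis
      using that lborel_integrable_real_affine[of "\<lambda>x. indicator {..<0} x * (norm (h x))\<^sup>2" "-1" 0]
      by (simp add: L2_on_def i)
  qed
  have L2m: "L2_on {0<..} (\<lambda>x. - h x)" if "L2_on {0<..} h" for h
    using that borel_measurable_uminus[of "\<lambda>x. indicator {0<..} x *\<^sub>R h x" lborel] by (simp add: L2_on_def)
  have i: "indicator {- x..0} (- t) = (indicator {0..x} t :: real)" for x t :: real by (auto simp: indicator_def)
  have int: "set_integrable lborel {0..x} (\<lambda>x. f' (- x))"
    and eq: "(LINT t:{0..x}|lborel. f' (- t)) = (LINT t:{-x..0}|lborel. f' t)" if "x > 0" for x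
    using assms that lborel_integrable_real_affine[of "\<lambda>t. indicator {-x..0} t *\<^sub>R f' t" "-1" 0]
      lborel_integral_real_affine[of "-1" "\<lambda>t. indicator {-x..0} t *\<^sub>R f' t" 0]
    by (simp_all add: H1L_def set_integrable_def set_lebesgue_integral_def i)
  have "AE x in lborel. - x < 0 \<longrightarrow> f (- x) = c - (LINT t:{-x..0}|lborel. f' t)"
    using assms by (intro AE_lborel_reflect) (auto simp: H1L_def)
  then have "AE x in lborel. x > 0 \<longrightarrow> f (- x) = c + (LINT t:{0..x}|lborel. - f' (- t))"
  proof eventually_elim
    case (elim x)
    show ?case using elim eq[of x] by (auto simp: set_lebesgue_integral_def)
  qed
  moreover have "set_integrable lborel {0..x} (\<lambda>x. - f' (- x))" if "x > 0" for x
    using int[OF that] by (simp add: set_integrable_def)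
  ultimately show ?thesis
    using assms L2 L2m by (auto simp: H1R_def H1L_def)
qed

text \<open>The sign s is 1 on the right half line and -1 on the reflected left one. Square
  integrability leaves one free amplitude, which fixes the ratio of the components of the
  trace.\<close>

lemma (in gap_point) half_line_solution:
  assumes H: "H1R psi c psi'" and s: "s\<^sup>2 = 1"
    and ode: "AE x in lborel. x > 0 \<longrightarrow> psi' x = s *s (Dirac_ode m z *v psi x)"
  shows "c $ 1 = s * \<zeta> * c $ 2"
    and "c = 0 \<Longrightarrow> AE x in lborel. x > 0 \<longrightarrow> psi x = 0"
proof -
  text \<open>The combinations \<^term>\<open>\<lambda>x. psi x $ 1 + r * \<zeta> * psi x $ 2\<close> with \<^term>\<open>r\<^sup>2 = 1\<close> diagonalise the system.\<close>
  define u where "u r v = v $ 1 + r * \<zeta> * v $ 2" for r and v :: cvec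
  have Lin: "bounded_linear (u r)" for r
    unfolding linear_conv_bounded_linear[symmetric] linear_iff u_def by (auto simp: algebra_simps)
  have diag: "u r (s *s (Dirac_ode m z *v v)) = (s * r * \<i> * k) * u r v" if "r\<^sup>2 = 1" for r v
  proof -
    have "\<zeta> * inverse \<zeta> = 1" using zeta_nz by simp
    then show ?thesis
      using that unfolding Dirac_ode_def zeta_k[symmetric] inverse_zeta_k[symmetric] u_def
      by (simp add: cmat_vec_simps) algebra
  qed
  have sol: "AE x in lborel. x > 0 \<longrightarrow> u r (psi x) = u r c * exp (s * r * \<i> * k * complex_of_real x)"
    if r: "r\<^sup>2 = 1" for r
  proof (rule linear_ode_AE)
    have i: "set_integrable lborel {0..x} psi'" if "x > 0" for x using H that by (auto simp: H1R_def)
    show "set_integrable lborel {0..x} (\<lambda>t. u r (psi' t))" if "x > 0" for x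
      by (rule set_integral_bounded_linear(1)[OF Lin i[OF that]])
    have "AE x in lborel. x > 0 \<longrightarrow> psi x = c + (LINT t:{0..x}|lborel. psi' t)"
      using H by (auto simp: H1R_def)
    then show "AE x in lborel. x > 0 \<longrightarrow> u r (psi x) = u r c + (LINT t:{0..x}|lborel. u r (psi' t))"
      by eventually_elim (auto simp: set_integral_bounded_linear(2)[OF Lin i] linear_add bounded_linear.linear[OF Lin])
    show "AE x in lborel. x > 0 \<longrightarrow> u r (psi' x) = s * r * \<i> * k * u r (psi x)"
      using ode by eventually_elim (auto simp: diag[OF r])
  qed
  obtain K where K: "norm (u (- s) v) \<le> norm v * K" for v using bounded_linear.bounded[OF Lin] by blast
  \<comment> \<open>For r = - s the exponent is - i k, with real part Im k > 0: this is the growing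
    mode.\<close>
  have "u (- s) c = 0"
  proof (rule exp_growth_not_L2)
    show "(norm (u (- s) (psi x)))\<^sup>2 \<le> K\<^sup>2 * (norm (psi x))\<^sup>2" for x
      using power_mono[OF K[of "psi x"], of 2] by (simp add: power_mult_distrib mult.commute)
    have "integrable lborel (\<lambda>x. indicator {0<..} x * (norm (psi x))\<^sup>2)" using H by (auto simp: H1R_def L2_on_def)
    from integrable_mult_right[OF this, of "K\<^sup>2"]
    show "integrable lborel (\<lambda>x. indicator {0<..} x * (K\<^sup>2 * (norm (psi x))\<^sup>2))" by (simp add: mult.left_commute)
    show "AE x in lborel. x > 0 \<longrightarrow> u (- s) (psi x) = u (- s) c * exp (s * (- s) * \<i> * k * complex_of_real x)"
      by (rule sol) (simp add: s)
    have "s * (- s) = - 1" using s by (simp add: power2_eq_square)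
    then show "0 \<le> Re (s * (- s) * \<i> * k)" using kk(2) by simp
  qed
  then show "c $ 1 = s * \<zeta> * c $ 2" by (simp add: u_def)
  assume c: "c = 0"
  have "AE x in lborel. x > 0 \<longrightarrow> u 1 (psi x) = 0" "AE x in lborel. x > 0 \<longrightarrow> u (- 1) (psi x) = 0"
    using sol[of 1] sol[of "- 1"] by (simp_all add: c u_def)
  then show "AE x in lborel. x > 0 \<longrightarrow> psi x = 0"
    by eventually_elim (use zeta_nz in \<open>auto simp: u_def vec_eq_iff forall_2\<close>)
qed

subsection \<open>The resolvent of the point interaction\<close>

lemma matrix_inv_mult:
  assumes "det (N :: complex^'n^'n) \<noteq> 0"
  shows "N ** matrix_inv N = mat 1" and "matrix_inv N ** N = mat 1"
proof -
  have "\<exists>N'. N ** N' = mat 1 \<and> N' ** N = mat 1"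
    using assms by (simp add: invertible_det_nz[symmetric] invertible_def)
  from someI_ex[OF this] show "N ** matrix_inv N = mat 1" and "matrix_inv N ** N = mat 1"
    by (auto simp: matrix_inv_def)
qed

lemma L2_on_indicator: "L2_on S f \<longleftrightarrow> L2_on UNIV (\<lambda>x. indicator S x *\<^sub>R f x)"
proof -
  have "(norm (indicator S x *\<^sub>R f x))\<^sup>2 = indicator S x * (norm (f x))\<^sup>2" for x
    by (simp add: indicator_def)
  then show ?thesis by (simp add: L2_on_def)
qed

section \<open>Differences of elements of the graph\<close>

lemma L2_on_diff_on:
  assumes "L2_on S f" "L2_on S g"
  shows "L2_on S (\<lambda>x. f x - g x)"
  using L2_on_diff[OF assms[unfolded L2_on_indicator[of S]]]
  by (simp add: L2_on_indicator[of S] scaleR_diff_right)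

lemma H1R_diff:
  assumes f: "H1R f c f'" and g: "H1R g d g'"
  shows "H1R (\<lambda>x. f x - g x) (c - d) (\<lambda>x. f' x - g' x)"
proof -
  have i: "set_integrable lborel {0..x} f'" "set_integrable lborel {0..x} g'" if "x > 0" for x
    using f g that by (auto simp: H1R_def)
  have "AE x in lborel. x > 0 \<longrightarrow> f x = c + (LINT t:{0..x}|lborel. f' t)"
    "AE x in lborel. x > 0 \<longrightarrow> g x = d + (LINT t:{0..x}|lborel. g' t)"
    using f g by (auto simp: H1R_def)
  then have "AE x in lborel. x > 0 \<longrightarrow> f x - g x = c - d + (LINT t:{0..x}|lborel. f' t - g' t)"
    by eventually_elim (simp add: set_integral_diff(2)[OF i])
  then show ?thesis
    using f g i by (auto simp: H1R_def intro!: L2_on_diff_on set_integral_diff(1))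
qed

lemma H1L_diff:
  assumes f: "H1L f c f'" and g: "H1L g d g'"
  shows "H1L (\<lambda>x. f x - g x) (c - d) (\<lambda>x. f' x - g' x)"
proof -
  have i: "set_integrable lborel {x..0} f'" "set_integrable lborel {x..0} g'" if "x < 0" for x
    using f g that by (auto simp: H1L_def)
  have "AE x in lborel. x < 0 \<longrightarrow> f x = c - (LINT t:{x..0}|lborel. f' t)"
    "AE x in lborel. x < 0 \<longrightarrow> g x = d - (LINT t:{x..0}|lborel. g' t)"
    using f g by (auto simp: H1L_def)
  then have "AE x in lborel. x < 0 \<longrightarrow> f x - g x = c - d - (LINT t:{x..0}|lborel. f' t - g' t)"
    by eventually_elim (simp add: set_integral_diff(2)[OF i])
  then show ?thesis
    using f g i by (auto simp: H1L_def intro!: L2_on_diff_on set_integral_diff(1))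
qed

text \<open>Used for uniqueness: two solutions with the same right-hand side differ by a solution of
  the homogeneous equation.\<close>

lemma DA_graph_diff:
  assumes 1: "DA_graph m A psi1 chi1" and 2: "DA_graph m A psi2 chi2"
  shows "DA_graph m A (\<lambda>x. psi1 x - psi2 x) (\<lambda>x. chi1 x - chi2 x)"
proof -
  obtain cp1 cm1 d1 where H1: "H1R psi1 cp1 d1" "H1L psi1 cm1 d1"
    and bc1: "(cmat_scale (2 * \<i>) sigma1 - A) *v cp1 = (cmat_scale (2 * \<i>) sigma1 + A) *v cm1"
    and e1: "AE x in lborel. chi1 x = cmat_scale (- \<i>) sigma1 *v d1 x + cmat_scale (complex_of_real m) sigma3 *v psi1 x"
    using 1 unfolding DA_graph_def by blast
  obtain cp2 cm2 d2 where H2: "H1R psi2 cp2 d2" "H1L psi2 cm2 d2"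
    and bc2: "(cmat_scale (2 * \<i>) sigma1 - A) *v cp2 = (cmat_scale (2 * \<i>) sigma1 + A) *v cm2"
    and e2: "AE x in lborel. chi2 x = cmat_scale (- \<i>) sigma1 *v d2 x + cmat_scale (complex_of_real m) sigma3 *v psi2 x"
    using 2 unfolding DA_graph_def by blast
  have "AE x in lborel. chi1 x - chi2 x = cmat_scale (- \<i>) sigma1 *v (d1 x - d2 x)
      + cmat_scale (complex_of_real m) sigma3 *v (psi1 x - psi2 x)"
    using e1 e2 by eventually_elim (simp add: matrix_vector_mult_diff_distrib)
  moreover have "(cmat_scale (2 * \<i>) sigma1 - A) *v (cp1 - cp2) = (cmat_scale (2 * \<i>) sigma1 + A) *v (cm1 - cm2)"
    by (simp only: matrix_vector_mult_diff_distrib bc1 bc2)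
  moreover have "L2_on UNIV (\<lambda>x. psi1 x - psi2 x)" "L2_on UNIV (\<lambda>x. chi1 x - chi2 x)"
    using 1 2 by (auto simp: DA_graph_def intro!: L2_on_diff)
  ultimately show ?thesis
    unfolding DA_graph_def using H1R_diff[OF H1(1) H2(1)] H1L_diff[OF H1(2) H2(2)] by blast
qed

locale resolvent_point = gap_point +
  fixes A :: cmat
  assumes det_nz: "det (sigma0 + cmat_scale (\<i> / 2) (A ** ZZ m z)) \<noteq> 0"
begin

abbreviation "N \<equiv> sigma0 + cmat_scale (\<i> / 2) (A ** ZZ m z)"

definition res :: "(real \<Rightarrow> cvec) \<Rightarrow> real \<Rightarrow> cvec" where
  "res f x = (LINT y|lborel. RA m A z x y *v f y)"

section \<open>Boundedness of the integral operator\<close>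

lemma RA_mult:
  "RA m A z x y *v v = Rfree m z x y *v v - Rfree m z x 0 *v ((matrix_inv N ** A) *v (Rfree m z 0 y *v v))"
  unfolding RA_def by (simp add: matrix_vector_mult_diff_rdistrib matrix_vector_mul_assoc matrix_mul_assoc)

lemma Rfree_bound:
  obtains C where "C \<ge> 0" "\<And>x y v. norm (Rfree m z x y *v v) \<le> C * exp (- Im k * \<bar>x - y\<bar>) * norm v"
proof -
  obtain K where K: "0 \<le> K" "\<And>a b. norm (a *v b) \<le> norm (a :: cmat) * norm (b :: cvec) * K"
    using bounded_bilinear.nonneg_bounded[OF bounded_bilinear_matrix_vector_mult] by blast
  define P Q where "P = cmat_scale (\<i> / 2) (ZZ m z)" and "Q = cmat_scale (\<i> / 2) sigma1"
  have "norm (Rfree m z x y *v v) \<le> ((norm P + norm Q) * K) * exp (- Im k * \<bar>x - y\<bar>) * norm v" for x y v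
  proof -
    have "norm (P *v (exp_abs k x y *s v)) \<le> norm P * (exp (- Im k * \<bar>x - y\<bar>) * norm v) * K"
      using K(2)[of P "exp_abs k x y *s v"] by (simp add: norm_vector_scalar_mult norm_exp_abs)
    moreover have "norm (Q *v (sgn_exp_abs k x y *s v)) \<le> norm Q * (exp (- Im k * \<bar>x - y\<bar>) * norm v) * K"
    proof (rule order_trans[OF K(2)], intro mult_right_mono mult_left_mono K)
      show "norm (sgn_exp_abs k x y *s v) \<le> exp (- Im k * \<bar>x - y\<bar>) * norm v"
        unfolding norm_vector_scalar_mult by (intro mult_right_mono norm_sgn_exp_abs_le) auto
    qed auto
    ultimately show ?thesis
      unfolding Rfree_mult P_def[symmetric] Q_def[symmetric]
      by (intro order_trans[OF norm_triangle_ineq]) (simp add: algebra_simps)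
  qed
  moreover have "0 \<le> (norm P + norm Q) * K" using K(1) by simp
  ultimately show ?thesis using that by blast
qed

lemma RA_bound:
  obtains C where "C \<ge> 0" "\<And>x y v. norm (RA m A z x y *v v) \<le> exp (- Im k * \<bar>x - y\<bar>) * (C * norm v)"
proof -
  obtain C where C: "C \<ge> 0" "\<And>x y v. norm (Rfree m z x y *v v) \<le> C * exp (- Im k * \<bar>x - y\<bar>) * norm v"
    by (rule Rfree_bound) blast
  obtain K where K: "K \<ge> 0" "\<And>v. norm ((matrix_inv N ** A) *v v) \<le> norm v * K"
    using bounded_linear.nonneg_bounded[OF bounded_linear_matrix_vector_mult] by blast
  have "norm (RA m A z x y *v v) \<le> exp (- Im k * \<bar>x - y\<bar>) * ((C + C * K * C) * norm v)" for x y v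
  proof -
    define w where "w = (matrix_inv N ** A) *v (Rfree m z 0 y *v v)"
    have w: "norm w \<le> C * exp (- Im k * \<bar>y\<bar>) * norm v * K"
      using order_trans[OF K(2) mult_right_mono[OF C(2)[of 0 y v] K(1)]] by (simp add: w_def)
    have "norm (Rfree m z x 0 *v w) \<le> C * exp (- Im k * \<bar>x\<bar>) * (C * exp (- Im k * \<bar>y\<bar>) * norm v * K)"
      using order_trans[OF C(2)[of x 0 w] mult_left_mono[OF w]] C(1) by simp
    also have "\<dots> = exp (- Im k * (\<bar>x\<bar> + \<bar>y\<bar>)) * (C * K * C * norm v)"
      unfolding distrib_left exp_add by (simp only: mult_ac)
    \<comment> \<open>The triangle inequality through the origin turns the two separate decays into
      decay in the distance of x and y.\<close>
    also have "\<dots> \<le> exp (- Im k * \<bar>x - y\<bar>) * (C * K * C * norm v)"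
      using kk(2) C(1) K(1) by (intro mult_right_mono) auto
    finally show ?thesis
      using C(2)[of x y v] unfolding RA_mult w_def[symmetric]
      by (intro order_trans[OF norm_triangle_ineq4]) (simp add: algebra_simps)
  qed
  moreover have "0 \<le> C + C * K * C" using C(1) K(1) by simp
  ultimately show ?thesis using that by blast
qed

lemma res_L2:
  obtains C where "\<And>f x. L2_on UNIV f \<Longrightarrow> integrable lborel (\<lambda>y. RA m A z x y *v f y)"
    and "\<And>f. L2_on UNIV f \<Longrightarrow> L2_on UNIV (res f)"
    and "\<And>f. L2_on UNIV f \<Longrightarrow> L2norm (res f) \<le> C * L2norm f"
proof -
  obtain C where C: "C \<ge> 0" "\<And>x y v. norm (RA m A z x y *v v) \<le> exp (- Im k * \<bar>x - y\<bar>) * (C * norm v)"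
    by (rule RA_bound) blast
  define W where "W = (LINT t|lborel. exp (- Im k * \<bar>t\<bar>))"
  have W: "W \<ge> 0" by (simp add: W_def)
  have *: "integrable lborel (\<lambda>y. RA m A z x y *v f y) \<and> L2_on UNIV (res f) \<and> L2norm (res f) \<le> W * C * L2norm f"
    if f: "L2_on UNIV f" for f x
  proof -
    have [measurable]: "f \<in> borel_measurable lborel" and f2: "integrable lborel (\<lambda>x. (norm (f x))\<^sup>2)"
      using f by (auto simp: L2_on_UNIV_iff)
    have h: "(\<lambda>(x, y). RA m A z x y *v f y) \<in> borel_measurable (lborel \<Otimes>\<^sub>M lborel)"
      unfolding RA_mult Rfree_mult by measurable
    have G: "(\<lambda>y. C * norm (f y)) \<in> borel_measurable lborel" by measurable
    have G2: "integrable lborel (\<lambda>y. (C * norm (f y))\<^sup>2)" using f2 by (simp add: power_mult_distrib)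
    note ek = exp_kernel[OF h kk(2) C(2) G G2, folded res_def W_def]
    have "res f \<in> borel_measurable lborel"
      using lborel.borel_measurable_lebesgue_integral[OF h] by (simp add: res_def[abs_def])
    moreover have "L2norm (res f) \<le> W * C * L2norm f"
    proof -
      have "L2norm (res f) \<le> sqrt ((W * C)\<^sup>2 * (LINT y|lborel. (norm (f y))\<^sup>2))"
        unfolding L2norm_def using ek(4) by (simp add: power_mult_distrib mult.assoc)
      then show ?thesis using W C(1) by (simp add: L2norm_def real_sqrt_mult)
    qed
    ultimately show ?thesis using ek(1,3) by (simp add: L2_on_UNIV_iff)
  qed
  then show ?thesis using that by blast
qed

text \<open>The correction in the kernel is a product of a factor in x and one in y, so integration
  over y leaves a fixed vector feeding a source at the origin.\<close>

lemma res_eq: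
  assumes f: "L2_on UNIV f"
  shows "res f x = free_res f x - Rfree m z x 0 *v ((matrix_inv N ** A) *v free_res f 0)"
proof -
  note Lin = bounded_linear_compose[OF bounded_linear_matrix_vector_mult bounded_linear_matrix_vector_mult]
  show ?thesis
    unfolding res_def RA_mult free_res_def
    using integrable_Rfree[OF f] integrable_bounded_linear[OF Lin integrable_Rfree[OF f]]
      integral_bounded_linear[OF Lin integrable_Rfree[OF f]]
    by simp
qed

text \<open>One-sided traces at the origin of \<open>Rfree m z x 0 *v p\<close>: \<open>s = 1\<close> from the right,
  \<open>s = - 1\<close> from the left.\<close>

definition source_trace :: "complex \<Rightarrow> cvec \<Rightarrow> cvec" where
  "source_trace s p = cmat_scale (\<i> / 2) (ZZ m z + cmat_scale s sigma1) *v p"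

text \<open>At x = 0 the sign is 0 and the formula gives the mean of the two one-sided
  traces.\<close>

lemma Rfree_source:
  "Rfree m z x 0 *v p = exp_abs k x 0 *s source_trace (complex_of_real (sgn x)) p"
  by (simp add: cmat_vec_simps Rfree_def exp_abs_def source_trace_def algebra_simps)

text \<open>The range of \<open>ZZ\<close> + s \<open>sigma1\<close> consists of eigenvectors of
  \<open>Dirac_ode\<close> for the eigenvalue s i k.\<close>

lemma Dirac_ode_source:
  assumes "s\<^sup>2 = 1"
  shows "Dirac_ode m z *v (c *s source_trace s p) = (\<i> * k * (s * c)) *s source_trace s p"
proof -
  have "\<zeta> * inverse \<zeta> = 1" using zeta_nz by simp
  then show ?thesis
    using assms unfolding Dirac_ode_def zeta_k[symmetric] inverse_zeta_k[symmetric] source_trace_def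
    by (simp add: cmat_vec_simps) algebra
qed

text \<open>The interval may touch the origin but not cross it. The left-hand side is written with
  one-sided traces because the kernel itself takes the mean value at 0.\<close>

lemma Rfree_source_ode:
  assumes ab: "a \<le> b" and s: "\<And>t. t \<in> {a..b} \<Longrightarrow> t \<noteq> 0 \<Longrightarrow> sgn t = s" "s\<^sup>2 = 1"
  shows "exp_abs k b 0 *s source_trace (complex_of_real s) p - exp_abs k a 0 *s source_trace (complex_of_real s) p
    = (LINT t:{a..b}|lborel. Dirac_ode m z *v (Rfree m z t 0 *v p))"
proof -
  let ?c = "source_trace (complex_of_real s) p"
  have i: "set_integrable lborel {a..b} (\<lambda>t. \<i> * k * sgn_exp_abs k t 0)"
  proof (rule set_integrable_bounded)
    show "norm (\<i> * k * sgn_exp_abs k t 0) \<le> norm k * 1" for t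
      unfolding norm_mult norm_ii mult_1_left
      using kk(2) by (intro mult_left_mono order_trans[OF norm_sgn_exp_abs_le]) auto
  qed measurable
  note L = bounded_bilinear.bounded_linear_left[OF bounded_bilinear_vector_scalar_mult, of ?c]
  have "exp_abs k b 0 *s ?c - exp_abs k a 0 *s ?c = (exp_abs k b 0 - exp_abs k a 0) *s ?c"
    by (simp add: vec_eq_iff algebra_simps)
  also have "\<dots> = (LINT t:{a..b}|lborel. (\<i> * k * sgn_exp_abs k t 0) *s ?c)"
    unfolding exp_abs_primitive(1)[OF ab] by (rule set_integral_bounded_linear(2)[OF L i, symmetric])
  also have "\<dots> = (LINT t:{a..b}|lborel. Dirac_ode m z *v (Rfree m z t 0 *v p))"
    unfolding set_lebesgue_integral_def
  proof (rule integral_cong_AE)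
    show "(\<lambda>t. indicator {a..b} t *\<^sub>R ((\<i> * k * sgn_exp_abs k t 0) *s ?c)) \<in> borel_measurable lborel"
      by measurable
    show "(\<lambda>t. indicator {a..b} t *\<^sub>R (Dirac_ode m z *v (Rfree m z t 0 *v p))) \<in> borel_measurable lborel"
      unfolding Rfree_mult by measurable
    have s2: "(complex_of_real s)\<^sup>2 = 1" using s(2) by (metis of_real_1 of_real_power)
    show "AE t in lborel. indicator {a..b} t *\<^sub>R ((\<i> * k * sgn_exp_abs k t 0) *s ?c)
        = indicator {a..b} t *\<^sub>R (Dirac_ode m z *v (Rfree m z t 0 *v p))"
      using AE_lborel_singleton[of 0]
      by eventually_elim
        (auto simp: Rfree_source s(1) Dirac_ode_source[OF s2] sgn_exp_abs_def indicator_def)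
  qed
  finally show ?thesis .
qed

lemma res_graph:
  assumes f: "L2_on UNIV f"
  shows "DA_graph m A (res f) (\<lambda>x. z *s res f x + f x)"
proof -
  have L2: "L2_on UNIV (res f)" using res_L2 f by metis
  define p where "p = (matrix_inv N ** A) *v free_res f 0"
  have r: "res f x = free_res f x - Rfree m z x 0 *v p" for x unfolding p_def by (rule res_eq[OF f])
  define d where "d x = Dirac_ode m z *v res f x + cmat_scale \<i> sigma1 *v f x" for x
  note Lin = bounded_linear_matrix_vector_mult
  have D2: "L2_on UNIV (\<lambda>x. Dirac_ode m z *v free_res f x + cmat_scale \<i> sigma1 *v f x)"
    by (rule L2_on_add[OF L2_on_bounded_linear[OF Lin L2_on_free_res[OF f]] L2_on_bounded_linear[OF Lin f]])
  have d2: "L2_on UNIV d"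
    unfolding d_def[abs_def] by (rule L2_on_add[OF L2_on_bounded_linear[OF Lin L2] L2_on_bounded_linear[OF Lin f]])
  \<comment> \<open>The source term is the difference of two functions already known to be square
    integrable.\<close>
  have "L2_on UNIV (\<lambda>x. free_res f x - res f x)" by (rule L2_on_diff[OF L2_on_free_res[OF f] L2])
  then have S2: "L2_on UNIV (\<lambda>x. Rfree m z x 0 *v p)" by (simp add: r)
  have deq: "d x = (Dirac_ode m z *v free_res f x + cmat_scale \<i> sigma1 *v f x) - Dirac_ode m z *v (Rfree m z x 0 *v p)" for x
    by (simp add: d_def r matrix_vector_mult_diff_distrib)
  have dint: "(LINT t:{a..b}|lborel. d t) = (free_res f b - free_res f a)
      - (LINT t:{a..b}|lborel. Dirac_ode m z *v (Rfree m z t 0 *v p))" if "a \<le> b" for a b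
    unfolding deq free_res_ode[OF f that]
    by (rule set_integral_diff(2)[OF L2_on_set_integrable[OF D2] L2_on_set_integrable[OF L2_on_bounded_linear[OF Lin S2]]])
  define cp cm where "cp = free_res f 0 - source_trace 1 p" and "cm = free_res f 0 - source_trace (- 1) p"
  have "H1R (res f) cp d"
    unfolding H1R_def
  proof (intro conjI allI impI AE_I2)
    fix x :: real assume x: "x > 0"
    show "res f x = cp + (LINT t:{0..x}|lborel. d t)"
      using x Rfree_source_ode[of 0 x 1 p]
      by (simp add: dint r cp_def Rfree_source) (simp add: exp_abs_def algebra_simps)
  qed (use L2 d2 in \<open>auto intro: L2_on_subset L2_on_set_integrable\<close>)
  moreover have "H1L (res f) cm d"
    unfolding H1L_def
  proof (intro conjI allI impI AE_I2)
    fix x :: real assume x: "x < 0"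
    show "res f x = cm - (LINT t:{x..0}|lborel. d t)"
      using x Rfree_source_ode[of x 0 "- 1" p]
      by (simp add: dint r cm_def Rfree_source) (simp add: exp_abs_def algebra_simps)
  qed (use L2 d2 in \<open>auto intro: L2_on_subset L2_on_set_integrable\<close>)
  moreover have "(cmat_scale (2 * \<i>) sigma1 - A) *v cp = (cmat_scale (2 * \<i>) sigma1 + A) *v cm"
  proof -
    \<comment> \<open>Since cp - cm = - i \<open>sigma1\<close> p and cp + cm = 2
      \<open>free_res f 0\<close> - i \<open>ZZ\<close> p, the transmission condition is exactly
      this equation.\<close>
    have "N *v p = A *v free_res f 0"
      unfolding p_def matrix_vector_mul_assoc matrix_mul_assoc matrix_inv_mult(1)[OF det_nz] by simp
    then show ?thesis
      by (simp add: cp_def cm_def source_trace_def cmat_vec_simps) (use i_squared in algebra)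
  qed
  moreover have "z *s res f x + f x = cmat_scale (- \<i>) sigma1 *v d x + cmat_scale (complex_of_real m) sigma3 *v res f x" for x
    by (simp add: d_def Dirac_ode_def cmat_vec_simps algebra_simps)
  moreover have "L2_on UNIV (\<lambda>x. z *s res f x + f x)"
    by (rule L2_on_add[OF L2_on_bounded_linear[OF bounded_linear_vector_scalar_mult L2] f])
  ultimately show ?thesis using L2 unfolding DA_graph_def by blast
qed

text \<open>Decay gives cp1 = zeta cp2 on the right and cm1 = - zeta cm2 on the left. Invertibility
  of \<open>N\<close> makes the jump vanish, and the opposite signs then force both traces to be
  0.\<close>

lemma eigenfunction_zero:
  assumes g: "DA_graph m A psi chi" and ev: "AE x in lborel. chi x = z *s psi x"
  shows "AE x in lborel. psi x = 0"
proof -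
  obtain cp cm d where H: "H1R psi cp d" "H1L psi cm d"
    and bc: "(cmat_scale (2 * \<i>) sigma1 - A) *v cp = (cmat_scale (2 * \<i>) sigma1 + A) *v cm"
    and e: "AE x in lborel. chi x = cmat_scale (- \<i>) sigma1 *v d x + cmat_scale (complex_of_real m) sigma3 *v psi x"
    using g unfolding DA_graph_def by blast
  have ode: "AE x in lborel. d x = Dirac_ode m z *v psi x"
    using e ev
  proof eventually_elim
    case (elim x)
    then have "z *s psi x = cmat_scale (- \<i>) sigma1 *v d x + cmat_scale (complex_of_real m) sigma3 *v psi x" by simp
    then show ?case by (simp add: Dirac_ode_def cmat_vec_simps) (use i_squared in algebra)
  qed
  have R: "AE x in lborel. x > 0 \<longrightarrow> d x = 1 *s (Dirac_ode m z *v psi x)"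
    using ode by eventually_elim simp
  \<comment> \<open>Reflection reverses the derivative, which is the case s = -1.\<close>
  have L: "AE x in lborel. x > 0 \<longrightarrow> - d (- x) = (- 1) *s (Dirac_ode m z *v psi (- x))"
    using AE_lborel_reflect[OF ode] by eventually_elim (simp add: vec_eq_iff)
  have minus_one_sq: "(- 1 :: complex)\<^sup>2 = 1" by simp
  note hR = half_line_solution[OF H(1) power_one R]
  note hL = half_line_solution[OF H1L_reflect[OF H(2)] minus_one_sq L]
  define q :: cvec where "q = sigma1 *v (cp - cm)"
  \<comment> \<open>\<open>cp + cm = ZZ *v q\<close> by decay, so the transmission condition reads \<open>2 i q = A ** ZZ *v q\<close>.\<close>
  have "N *v q = 0"
  proof -
    have "\<zeta> * inverse \<zeta> = 1" using zeta_nz by simp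
    then show ?thesis
      using bc hR(1) hL(1) by (simp add: q_def cmat_vec_simps) (use i_squared in algebra)
  qed
  then have "(matrix_inv N ** N) *v q = 0" by (simp flip: matrix_vector_mul_assoc)
  then have "q = 0" unfolding matrix_inv_mult(2)[OF det_nz] by simp
  then have "cp $ 2 = cm $ 2" "cp $ 1 = cm $ 1" by (simp_all add: q_def cmat_vec_simps)
  moreover have "\<zeta> * cp $ 2 = - \<zeta> * cm $ 2" using calculation(2) hR(1) hL(1) by simp
  ultimately have "cp $ 2 = 0" "cm $ 2 = 0" using zeta_nz by auto
  then have "cp = 0" "cm = 0" using hR(1) hL(1) by (simp_all add: vec_eq_iff forall_2)
  from hR(2)[OF this(1)] AE_lborel_reflect[OF hL(2)[OF this(2)]] AE_lborel_singleton[of 0]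
  show ?thesis
    by eventually_elim (metis add.inverse_inverse linorder_neqE_linordered_idom neg_0_less_iff_less)
qed

end

section \<open>Resolvent set and integral kernel\<close>

theorem theorem3p2:
  fixes m :: real and A :: cmat and z :: complex
  assumes z_dom: "z \<notin> complex_of_real ` ({..- \<bar>m\<bar>} \<union> {\<bar>m\<bar>..})"
    and det_nz: "det (sigma0 + cmat_scale (\<i> / 2) (A ** ZZ m z)) \<noteq> 0"
  shows "in_resolvent_set (DA_graph m A) z \<and>
    (\<forall>f. L2_on UNIV f \<longrightarrow>
       (AE x in lborel. integrable lborel (\<lambda>y. RA m A z x y *v f y)) \<and>
       (\<exists>chi. DA_graph m A (\<lambda>x. LINT y|lborel. RA m A z x y *v f y) chi \<and>
          (AE x in lborel. chi x - z *s (LINT y|lborel. RA m A z x y *v f y) = f x)))"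
proof -
  interpret resolvent_point m z A by unfold_locales (fact z_dom det_nz)+
  obtain C where C: "\<And>f x. L2_on UNIV f \<Longrightarrow> integrable lborel (\<lambda>y. RA m A z x y *v f y)"
      "\<And>f. L2_on UNIV f \<Longrightarrow> L2norm (res f) \<le> C * L2norm f"
    by (rule res_L2) blast
  have sol: "\<exists>chi. DA_graph m A (res f) chi \<and> (AE x in lborel. chi x - z *s res f x = f x)" if "L2_on UNIV f" for f
    using res_graph[OF that] by (intro exI conjI) auto
  have bound: "L2norm psi \<le> C * L2norm (\<lambda>x. chi x - z *s psi x)" if g: "DA_graph m A psi chi" for psi chi
  proof -
    define f where "f x = chi x - z *s psi x" for x
    have L2: "L2_on UNIV psi" "L2_on UNIV chi" using g by (auto simp: DA_graph_def)
    have f: "L2_on UNIV f"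
      unfolding f_def[abs_def]
      by (rule L2_on_diff[OF L2(2) L2_on_bounded_linear[OF bounded_linear_vector_scalar_mult L2(1)]])
    \<comment> \<open>Both functions solve the equation with right-hand side \<open>f\<close>, so
      injectivity identifies them and the bound for \<open>res\<close> passes to
      \<open>psi\<close>.\<close>
    have "AE x in lborel. psi x - res f x = 0"
      by (rule eigenfunction_zero[OF DA_graph_diff[OF g res_graph[OF f]]])
        (simp add: f_def vec_eq_iff algebra_simps)
    then have "AE x in lborel. (norm (psi x))\<^sup>2 = (norm (res f x))\<^sup>2" by eventually_elim simp
    moreover have "psi \<in> borel_measurable lborel" "res f \<in> borel_measurable lborel"
      using L2 res_graph[OF f] by (auto simp: DA_graph_def L2_on_UNIV_iff)
    ultimately have "L2norm psi = L2norm (res f)"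
      unfolding L2norm_def by (intro arg_cong[where f=sqrt] integral_cong_AE) auto
    then show ?thesis using C(2)[OF f] by (simp add: f_def[abs_def])
  qed
  have "in_resolvent_set (DA_graph m A) z"
    unfolding in_resolvent_set_def using eigenfunction_zero sol bound by blast
  then show ?thesis using C(1) sol by (simp add: res_def[abs_def])
qed

end
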